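(* There is an algorithm that, given an instance $(G,k)$ of Identification to Forest, outputs in polynomial time an equivalent instance $(G',k')$ of Identification to Forest where $|G'|\le 2k+1$ and $k'\le k+1$.
   Context: A graph $G$ admits a $k$-identification to a graph class $\mathcal{H}$ if there is a partition $\mathcal{P}=\{S_1,\dots,S_r\}$ of some set $S\subseteq V(G)$ with $|S|\le k$ such that identifying each $S_i$ into a single vertex (deleting $S_i$ and adding a new vertex adjacent to all neighbours of $S_i$ outside $S_i$) yields a graph in $\mathcal{H}$. The problem Identification to Forest asks, given a graph $G$ and $k\in\mathbb{N}$, whether $G$ admits a $k$-identification to the class of acyclic graphs (forests). Here $|G|$ denotes the number of vertices of $G$.
   Formalization: For no-instances with k = 0 the bound |G'| ≤ 2k+1 = 1 is replaced by |G'| ≤ 3, since every graph with at most one vertex is a forest and so a yes-instance, while (K3, 0) is a no-instance; all other cases keep |G'| ≤ 2k+1. *)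

theory Defs
  imports Main "HOL-Library.Disjoint_Sets" "HOL-Computational_Algebra.Polynomial"
begin

section \<open>Graphs and vertex identification\<close>

record 'a graph =
  verts :: "'a set"
  edges :: "'a set set"

definition simple_graph :: "'a graph \<Rightarrow> bool" where
  "simple_graph G \<longleftrightarrow> finite (verts G) \<and> (\<forall>e\<in>edges G. e \<subseteq> verts G \<and> card e = 2)"

definition is_cycle :: "'a graph \<Rightarrow> 'a list \<Rightarrow> bool" where
  "is_cycle G vs \<longleftrightarrow> length vs \<ge> 3 \<and> distinct vs \<and> set vs \<subseteq> verts G \<and>
     (\<forall>i<length vs. {vs ! i, vs ! (Suc i mod length vs)} \<in> edges G)"

definition forest :: "'a graph \<Rightarrow> bool" where
  "forest G \<longleftrightarrow> (\<nexists>vs. is_cycle G vs)"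

text \<open>
  In the identified graph, \<open>Inl v\<close> is a surviving vertex of \<open>G\<close>, and \<open>Inr X\<close> is the new vertex
  that replaces the block \<open>X\<close>.
\<close>

definition ident_map :: "'a set set \<Rightarrow> 'a \<Rightarrow> 'a + 'a set" where
  "ident_map P v = (if v \<in> \<Union>P then Inr (THE X. X \<in> P \<and> v \<in> X) else Inl v)"

text \<open>
  All blocks are identified simultaneously. As the blocks are disjoint, this is the result of
  identifying them one after the other, in any order. Edges inside a block disappear and
  parallel edges are merged.
\<close>

definition identify :: "'a graph \<Rightarrow> 'a set set \<Rightarrow> ('a + 'a set) graph" where
  "identify G P =
     \<lparr> verts = Inl ` (verts G - \<Union>P) \<union> Inr ` P,
       edges = {{ident_map P u, ident_map P v} | u v.
                  {u, v} \<in> edges G \<and> ident_map P u \<noteq> ident_map P v} \<rparr>"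

definition admits_identification ::
  "nat \<Rightarrow> (('a + 'a set) graph \<Rightarrow> bool) \<Rightarrow> 'a graph \<Rightarrow> bool" where
  "admits_identification k \<H> G \<longleftrightarrow>
     (\<exists>S P. S \<subseteq> verts G \<and> card S \<le> k \<and> partition_on S P \<and> \<H> (identify G P))"

text \<open>
  An instance is a finite simple graph, on the vertices \<open>0, \<dots>, n - 1\<close> so that it can be written
  down as the input of an algorithm, together with a natural number.
\<close>

type_synonym inst = "nat graph \<times> nat"

definition instances :: "inst set" where
  "instances = {(G, k). simple_graph G \<and> verts G = {..<card (verts G)}}"

definition Identification_to_Forest :: "inst \<Rightarrow> bool" where
  "Identification_to_Forest = (\<lambda>(G, k). admits_identification k forest G)"


section \<open>A model of computation\<close>

text \<open>
  The model is the WHILE language of Jones (Computability and Complexity, MIT Press, 1997):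
  imperative programs over binary trees. Jones charges every operation one unit of time; here
  evaluating an expression costs the total size of the values of all its subexpressions. Hence no
  value can be larger than the time spent so far plus the input size, structure sharing gives no
  advantage, and the functions computable in polynomial time are exactly those that
  are computable in polynomial time by Turing machines.
\<close>

datatype tree = Leaf | Node tree tree

fun tsize :: "tree \<Rightarrow> nat" where
  "tsize Leaf = 1"
| "tsize (Node l r) = tsize l + tsize r + 1"

fun left :: "tree \<Rightarrow> tree" where
  "left Leaf = Leaf"
| "left (Node l r) = l"

fun right :: "tree \<Rightarrow> tree" where
  "right Leaf = Leaf"
| "right (Node l r) = r"

type_synonym store = "nat \<Rightarrow> tree"

datatype expr = EVar nat | ELeaf | ENode expr expr | ELeft expr | ERight expr

fun val :: "store \<Rightarrow> expr \<Rightarrow> tree" where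
  "val s (EVar x) = s x"
| "val s ELeaf = Leaf"
| "val s (ENode a b) = Node (val s a) (val s b)"
| "val s (ELeft a) = left (val s a)"
| "val s (ERight a) = right (val s a)"

fun cost :: "store \<Rightarrow> expr \<Rightarrow> nat" where
  "cost s (EVar x) = tsize (s x)"
| "cost s ELeaf = 1"
| "cost s (ENode a b) = cost s a + cost s b + tsize (val s (ENode a b))"
| "cost s (ELeft a) = cost s a + tsize (val s (ELeft a))"
| "cost s (ERight a) = cost s a + tsize (val s (ERight a))"

datatype com =
    Assign nat expr
  | Seq com com
  | If expr com com
  | While expr com

text \<open>
  \<open>exec c s t s'\<close>: started in store \<open>s\<close>, the program \<open>c\<close> terminates after time \<open>t\<close> in store \<open>s'\<close>.
  A test succeeds if its value is not \<open>Leaf\<close>.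
\<close>

inductive exec :: "com \<Rightarrow> store \<Rightarrow> nat \<Rightarrow> store \<Rightarrow> bool" where
  Assign: "exec (Assign x e) s (cost s e + 1) (s(x := val s e))"
| Seq: "exec c\<^sub>1 s t\<^sub>1 s' \<Longrightarrow> exec c\<^sub>2 s' t\<^sub>2 s'' \<Longrightarrow> exec (Seq c\<^sub>1 c\<^sub>2) s (t\<^sub>1 + t\<^sub>2) s''"
| IfTrue: "val s e \<noteq> Leaf \<Longrightarrow> exec c\<^sub>1 s t s' \<Longrightarrow> exec (If e c\<^sub>1 c\<^sub>2) s (cost s e + 1 + t) s'"
| IfFalse: "val s e = Leaf \<Longrightarrow> exec c\<^sub>2 s t s' \<Longrightarrow> exec (If e c\<^sub>1 c\<^sub>2) s (cost s e + 1 + t) s'"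
| WhileFalse: "val s e = Leaf \<Longrightarrow> exec (While e c) s (cost s e + 1) s"
| WhileTrue: "val s e \<noteq> Leaf \<Longrightarrow> exec c s t\<^sub>1 s' \<Longrightarrow> exec (While e c) s' t\<^sub>2 s'' \<Longrightarrow>
    exec (While e c) s (cost s e + 1 + t\<^sub>1 + t\<^sub>2) s''"

lemma exec_deterministic:
  "exec c s t s' \<Longrightarrow> exec c s u s'' \<Longrightarrow> t = u \<and> s' = s''"
proof (induction arbitrary: u s'' rule: exec.induct)
  case Assign
  from Assign.prems show ?case by cases simp
next
  case Seq
  from Seq.prems show ?case by cases (use Seq.IH in blast)
next
  case IfTrue
  from IfTrue.prems show ?case by cases (use IfTrue.IH IfTrue.hyps in blast)+
next
  case IfFalse
  from IfFalse.prems show ?case by cases (use IfFalse.IH IfFalse.hyps in blast)+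
next
  case WhileFalse
  from WhileFalse.prems show ?case by cases (use WhileFalse.hyps in blast)+
next
  case WhileTrue
  from WhileTrue.prems show ?case by cases (use WhileTrue.IH WhileTrue.hyps in blast)+
qed

text \<open>
  The input is passed in register 0, all other registers initially hold \<open>Leaf\<close>, and the output is
  returned in register 0.
\<close>

definition polynomial_time_on :: "'a set \<Rightarrow> ('a \<Rightarrow> tree) \<Rightarrow> ('a \<Rightarrow> 'a) \<Rightarrow> bool" where
  "polynomial_time_on D enc f \<longleftrightarrow>
     (\<exists>(c :: com) (p :: nat poly). \<forall>x\<in>D. \<exists>t s.
        exec c ((\<lambda>_. Leaf)(0 := enc x)) t s \<and> s 0 = enc (f x) \<and> t \<le> poly p (tsize (enc x)))"


section \<open>Encoding of instances\<close>

fun enc_bool :: "bool \<Rightarrow> tree" where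
  "enc_bool False = Leaf"
| "enc_bool True = Node Leaf Leaf"

fun enc_list :: "('a \<Rightarrow> tree) \<Rightarrow> 'a list \<Rightarrow> tree" where
  "enc_list f [] = Leaf"
| "enc_list f (x # xs) = Node (f x) (enc_list f xs)"

text \<open>Binary expansion, least significant bit first.\<close>

fun bits :: "nat \<Rightarrow> bool list" where
  "bits n = (if n = 0 then [] else odd n # bits (n div 2))"

declare bits.simps [simp del]

definition adj_matrix :: "nat graph \<Rightarrow> bool list list" where
  "adj_matrix G = (let n = card (verts G) in
     map (\<lambda>u. map (\<lambda>v. {u, v} \<in> edges G) [0..<n]) [0..<n])"

definition enc_inst :: "inst \<Rightarrow> tree" where
  "enc_inst = (\<lambda>(G, k).
     Node (enc_list (enc_list enc_bool) (adj_matrix G)) (enc_list enc_bool (bits k)))"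

lemma enc_bool_inj: "enc_bool a = enc_bool b \<longleftrightarrow> a = b"
  by (cases a; cases b) auto

lemma enc_list_inj:
  assumes "\<And>x y. f x = f y \<longleftrightarrow> x = y"
  shows "enc_list f xs = enc_list f ys \<longleftrightarrow> xs = ys"
proof (induction xs arbitrary: ys)
  case Nil
  then show ?case by (cases ys) auto
next
  case (Cons x xs)
  then show ?case by (cases ys) (auto simp: assms)
qed

lemma bits_inj: "bits m = bits n \<longleftrightarrow> m = n"
proof
  show "bits m = bits n \<Longrightarrow> m = n"
  proof (induction m arbitrary: n rule: less_induct)
    case (less m)
    show ?case
    proof (cases "m = 0 \<or> n = 0")
      case True
      with less.prems show ?thesis
        by (auto simp: bits.simps[of m] bits.simps[of n] split: if_splits)
    next
      case False
      then have "odd m = odd n" "bits (m div 2) = bits (n div 2)"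
        using less.prems by (auto simp: bits.simps[of m] bits.simps[of n])
      moreover from this(2) have "m div 2 = n div 2"
        using less.IH[of "m div 2"] False by auto
      ultimately show ?thesis
        by (metis odd_two_times_div_two_succ even_two_times_div_two)
    qed
  qed
qed auto

lemma enc_inst_inj: "inj_on enc_inst instances"
proof (rule inj_onI)
  fix x y assume x: "x \<in> instances" and y: "y \<in> instances" and eq: "enc_inst x = enc_inst y"
  obtain G k where xk: "x = (G, k)" by (cases x)
  obtain H l where yl: "y = (H, l)" by (cases y)
  have kl: "k = l" and adj: "adj_matrix G = adj_matrix H"
    using eq by (auto simp: xk yl enc_inst_def enc_list_inj enc_bool_inj bits_inj)
  have n: "card (verts G) = card (verts H)"
    using arg_cong[OF adj, of length] by (simp add: adj_matrix_def Let_def)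
  have V: "verts G = verts H"
    using x y n by (simp add: instances_def xk yl)
  have uv: "{u, v} \<in> edges G \<longleftrightarrow> {u, v} \<in> edges H" if "u < card (verts G)" "v < card (verts G)" for u v
  proof -
    have "adj_matrix G ! u ! v = adj_matrix H ! u ! v" using adj by simp
    then show ?thesis using that n by (simp add: adj_matrix_def Let_def)
  qed
  have pair: "\<exists>u v. e = {u, v} \<and> u < card (verts G) \<and> v < card (verts G)"
    if "e \<in> edges G \<or> e \<in> edges H" for e
  proof -
    have "e \<subseteq> {..<card (verts G)}" "card e = 2"
      using that x y n by (auto simp: instances_def simple_graph_def xk yl)
    then show ?thesis by (auto simp: card_2_iff)
  qed
  have "edges G = edges H" using pair uv by blast
  then show "x = y" using V kl by (simp add: xk yl)
qed


section \<open>Small instances\<close>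

text \<open>
  For \<open>k = 0\<close> the bound \<open>2 * k + 1\<close> on the number of vertices is 1, and by the first lemma no
  graph with at most two vertices gives a negative instance. By the second lemma, negative
  instances with \<open>k = 0\<close> exist, and three vertices suffice for them.
\<close>

lemma small_Identification_to_Forest:
  assumes "simple_graph G" and "card (verts G) \<le> 2"
  shows "Identification_to_Forest (G, k)"
proof -
  have "\<not> is_cycle (identify G {}) vs" for vs
  proof
    assume "is_cycle (identify G {}) vs"
    then have vs: "length vs \<ge> 3" "distinct vs" "set vs \<subseteq> Inl ` verts G"
      by (auto simp: is_cycle_def identify_def)
    have fin: "finite (verts G)" using assms(1) by (simp add: simple_graph_def)
    have "length vs = card (set vs)" using vs(2) by (simp add: distinct_card)
    also have "\<dots> \<le> card (verts G)" using surj_card_le[OF fin vs(3)] .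
    also have "\<dots> \<le> 2" by (fact assms(2))
    finally show False using vs(1) by simp
  qed
  then show ?thesis
    unfolding Identification_to_Forest_def admits_identification_def forest_def
    by (auto intro!: exI[of _ "{}"] simp: partition_on_empty)
qed

lemma triangle_not_Identification_to_Forest:
  defines "K3 \<equiv> \<lparr> verts = {..<3::nat}, edges = {{0, 1}, {1, 2}, {2, 0}} \<rparr>"
  shows "(K3, 0) \<in> instances" and "\<not> Identification_to_Forest (K3, 0)"
proof -
  show "(K3, 0) \<in> instances"
    by (auto simp: K3_def instances_def simple_graph_def)
  have "is_cycle (identify K3 {}) [Inl 0, Inl 1, Inl 2]"
  proof -
    have "{Inl u, Inl v} \<in> edges (identify K3 {})" if "{u, v} \<in> edges K3" "u \<noteq> v" for u v
    proof -
      have "{Inl u, Inl v} = {ident_map {} u, ident_map {} v}" "ident_map {} u \<noteq> ident_map {} v"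
        using that(2) by (simp_all add: ident_map_def)
      then show ?thesis using that(1) unfolding identify_def by auto
    qed
    then have "{Inl 0, Inl 1} \<in> edges (identify K3 {})" "{Inl 1, Inl 2} \<in> edges (identify K3 {})"
      "{Inl 2, Inl 0} \<in> edges (identify K3 {})"
      by (simp_all add: K3_def)
    moreover have "verts (identify K3 {}) = Inl ` {..<3}"
      by (simp add: identify_def K3_def)
    ultimately show ?thesis
      by (auto simp: is_cycle_def less_Suc_eq numeral_2_eq_2)
  qed
  moreover have "P = {}" if "S \<subseteq> verts K3" "card S \<le> 0" "partition_on S P" for S P
  proof -
    have "finite S" using that(1) finite_subset by (fastforce simp: K3_def)
    then have "S = {}" using that(2) by simp
    then show ?thesis using that(3) by (simp add: partition_on_empty)
  qed
  ultimately show "\<not> Identification_to_Forest (K3, 0)"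
    unfolding Identification_to_Forest_def admits_identification_def forest_def by blast
qed

end

(*
Let G be a graph. If identifying the blocks of S yields a forest, then S meets every edge of G that
is not a bridge: such an edge with both ends outside S would survive and still lie on a cycle.
Conversely, let X be a vertex cover of the nonbridges. Identifying, in each component of the graph
of nonbridges, the part of X in it turns every component into a star, and the bridges join these
stars in a forest. So Identification to Forest is Vertex Cover on the graph H of nonbridges.

The kernel is that of Nemhauser and Trotter: a minimum vertex cover C of the bipartite double cover
of H yields a vertex cover instance on C with the same budget k, and C has more than 2k elements only
for negative instances. A universal vertex, which raises the budget by one, puts every edge into a
triangle, so that the nonbridges of the resulting graph are the edges that matter.

C is found by an auction, which avoids augmenting paths: an unmatched left vertex takes its cheapest
neighbour and raises the price of it by one, and gives up when all its neighbours cost more than n.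
As there are n prices, some level in {1, ..., n + 1} is not a price; C consists of the right vertices
above that level and of the left vertices that own a right vertex below it.
*)
theory Submission
  imports Defs "HOL-Library.Transitive_Closure_Table"
begin

section \<open>Polynomial time for functions between encoded types\<close>

text \<open>The budget \<open>k\<close> is written in binary and may be exponential in the size of
  the input, so it must never be expanded to unary. The algorithm only increments it and compares 2k
  with the size of the cover by counting down. The usual Nemhauser-Trotter reduction lowers the
  budget by the number of vertices with both copies in C; here such a vertex keeps its two copies,
  joined by an edge that costs exactly one unit, so nothing has to be subtracted.

  The auction is that of Bertsekas with unit increments, with prices as dual variables. It is
  optimal only up to an error of one per owner, and the level that is not a price absorbs this
  error: an owner cannot be pushed across an empty level by a slack of one.

  With the universal vertex the kernel has |C| + 1 \<le> 2k + 1 vertices. If |C| > 2k, the output is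
  a triangle with budget 0, whose three vertices exceed 2k + 1 only for k = 0.

  Running time is not argued on program texts: the algorithm is a HOL function, and
  \<open>ptime\<close> is closed under the operations of which it is composed.\<close>

class enc =
  fixes enc :: "'a \<Rightarrow> tree"

instantiation unit :: enc begin
definition "enc (x :: unit) = Leaf"
instance ..
end

instantiation bool :: enc begin
definition "enc = enc_bool"
instance ..
end

instantiation list :: (enc) enc begin
definition "enc = enc_list (enc :: 'a \<Rightarrow> tree)"
instance ..
end

instantiation prod :: (enc, enc) enc begin
definition "enc x = Node (enc (fst x)) (enc (snd x))"
instance ..
end

text \<open>Natural numbers are written in unary, so that they can be used as loop counters.\<close>

instantiation nat :: enc begin
definition "enc n = enc (replicate n ())"
instance ..
end

lemma enc_simps [simp]:
  "enc () = Leaf"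
  "enc False = Leaf" "enc True = Node Leaf Leaf"
  "enc [] = Leaf" "enc (y # ys) = Node (enc y) (enc ys)"
  "enc (a, b) = Node (enc a) (enc b)"
  by (simp_all add: enc_unit_def enc_bool_def enc_list_def enc_prod_def)

section \<open>Sizes of encodings and polynomial bounds\<close>

definition sz :: "'a::enc \<Rightarrow> nat" where
  "sz x = tsize (enc x)"

lemma tsize_pos: "tsize t \<ge> 1"
  by (cases t) auto

lemma sz_pos: "sz x \<ge> 1"
  unfolding sz_def by (rule tsize_pos)

lemma sz_simps [simp]:
  "sz () = 1" "sz [] = 1" "sz (y # ys) = sz y + sz ys + 1" "sz (a, b) = sz a + sz b + 1"
  by (simp_all add: sz_def)

lemma sz_bool: "sz (b :: bool) \<le> 3"
  by (cases b) (simp_all add: sz_def)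

lemma sz_nat: "sz (n :: nat) = 2 * n + 1"
  unfolding sz_def enc_nat_def by (induction n) auto

lemma sz_append: "sz (xs @ ys) + 1 = sz xs + sz ys"
  by (induction xs) auto

lemma sz_elem: "y \<in> set xs \<Longrightarrow> sz y \<le> sz xs"
  by (induction xs) auto

lemma length_le_sz: "length xs \<le> sz xs"
  by (induction xs) auto

lemma sz_list_le: "(\<And>y. y \<in> set xs \<Longrightarrow> sz y \<le> m) \<Longrightarrow> sz xs \<le> length xs * (m + 1) + 1"
  by (induction xs) fastforce+

definition pbound :: "('a::enc \<Rightarrow> nat) \<Rightarrow> bool" where
  "pbound F \<longleftrightarrow> (\<exists>p. \<forall>x. F x \<le> poly p (sz x))"

text \<open>The coefficients are natural numbers; this is why an estimate of a size may be
  substituted into a polynomial bound.\<close>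

lemma poly_nat_mono: "m \<le> n \<Longrightarrow> poly p m \<le> poly (p :: nat poly) n"
  by (induction p) (auto intro: add_mono mult_mono)

lemma pbound_const: "pbound (\<lambda>x. c)"
  unfolding pbound_def by (rule exI[of _ "[:c:]"]) simp

lemma pbound_sz: "pbound (\<lambda>x. sz x)"
  unfolding pbound_def by (rule exI[of _ "[:0, 1:]"]) simp

lemma pbound_add: "pbound F \<Longrightarrow> pbound G \<Longrightarrow> pbound (\<lambda>x. F x + G x)"
  unfolding pbound_def by (metis add_mono poly_add)

lemma pbound_mult: "pbound F \<Longrightarrow> pbound G \<Longrightarrow> pbound (\<lambda>x. F x * G x)"
  unfolding pbound_def by (metis mult_le_mono poly_mult)

lemma pbound_mono: "pbound G \<Longrightarrow> (\<And>x. F x \<le> G x) \<Longrightarrow> pbound F"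
  unfolding pbound_def by (meson le_trans)

lemma pbound_comp:
  assumes "pbound F" "pbound (\<lambda>x. sz (g x))"
  shows "pbound (\<lambda>x. F (g x))"
proof -
  obtain p q where p: "\<And>y. F y \<le> poly p (sz y)" and q: "\<And>x. sz (g x) \<le> poly q (sz x)"
    using assms unfolding pbound_def by blast
  have "F (g x) \<le> poly (pcompose p q) (sz x)" for x
    using le_trans[OF p poly_nat_mono[OF q]] by (simp add: poly_pcompose)
  then show ?thesis unfolding pbound_def by blast
qed

lemma pbound_Suc: "pbound F \<Longrightarrow> pbound (\<lambda>x. Suc (F x))"
  using pbound_add[OF _ pbound_const[of 1]] by auto

lemmas pbound_intros = pbound_const pbound_sz pbound_add pbound_mult pbound_Suc

section \<open>Time-bounded correctness of programs\<close>

definition runs :: "com \<Rightarrow> store \<Rightarrow> nat \<Rightarrow> (store \<Rightarrow> bool) \<Rightarrow> bool" where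
  "runs c s T Q \<longleftrightarrow> (\<exists>t s'. exec c s t s' \<and> t \<le> T \<and> Q s')"

lemma runs_Assign: "Q (s(x := val s e)) \<Longrightarrow> cost s e + 1 \<le> T \<Longrightarrow> runs (Assign x e) s T Q"
  unfolding runs_def using exec.Assign by blast

lemma runs_Seq:
  assumes "runs c\<^sub>1 s T\<^sub>1 Q\<^sub>1" "\<And>s'. Q\<^sub>1 s' \<Longrightarrow> runs c\<^sub>2 s' T\<^sub>2 Q" "T\<^sub>1 + T\<^sub>2 \<le> T"
  shows "runs (Seq c\<^sub>1 c\<^sub>2) s T Q"
proof -
  obtain t s' where 1: "exec c\<^sub>1 s t s'" "t \<le> T\<^sub>1" "Q\<^sub>1 s'" using assms(1) by (auto simp: runs_def)
  obtain u s'' where "exec c\<^sub>2 s' u s''" "u \<le> T\<^sub>2" "Q s''"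
    using assms(2)[OF 1(3)] by (auto simp: runs_def)
  then show ?thesis using exec.Seq[OF 1(1)] 1(2) assms(3) unfolding runs_def
    by (meson add_mono le_trans)
qed

lemma runs_Assign_Seq:
  assumes "runs c (s(x := val s e)) T\<^sub>2 Q" "cost s e + 1 + T\<^sub>2 \<le> T"
  shows "runs (Seq (Assign x e) c) s T Q"
  by (rule runs_Seq[where Q\<^sub>1 = "\<lambda>s'. s' = s(x := val s e)" and T\<^sub>1 = "cost s e + 1" and T\<^sub>2 = T\<^sub>2])
    (use assms in \<open>auto intro: runs_Assign\<close>)

lemma runs_If:
  assumes "val s e \<noteq> Leaf \<Longrightarrow> runs c\<^sub>1 s T' Q" "val s e = Leaf \<Longrightarrow> runs c\<^sub>2 s T' Q"
    "cost s e + 1 + T' \<le> T"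
  shows "runs (If e c\<^sub>1 c\<^sub>2) s T Q"
proof (cases "val s e = Leaf")
  case True
  then obtain t s' where "exec c\<^sub>2 s t s'" "t \<le> T'" "Q s'" using assms(2) by (auto simp: runs_def)
  then show ?thesis using exec.IfFalse[OF True] assms(3) unfolding runs_def
    by (meson add_left_mono le_trans)
next
  case False
  then obtain t s' where "exec c\<^sub>1 s t s'" "t \<le> T'" "Q s'" using assms(1) by (auto simp: runs_def)
  then show ?thesis using exec.IfTrue[OF False] assms(3) unfolding runs_def
    by (meson add_left_mono le_trans)
qed

text \<open>The list is a ghost variable that counts the remaining rounds and thereby gives
  termination. The strict bound on the test pays for the additional unit that a test costs, so a
  round takes at most \<open>2 * T'\<close>.\<close>

lemma runs_While_list:
  assumes "I ys s"
    and "\<And>s. I [] s \<Longrightarrow> val s e = Leaf \<and> cost s e < T' \<and> Q s"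
    and "\<And>s y zs. I (y # zs) s \<Longrightarrow>
      val s e \<noteq> Leaf \<and> cost s e < T' \<and> runs c s T' (I zs)"
    and "2 * T' * (length ys + 1) \<le> T"
  shows "runs (While e c) s T Q"
  using assms(1,4)
proof (induction ys arbitrary: s T)
  case Nil
  then show ?case using exec.WhileFalse[of s e c] assms(2)[OF Nil(1)] unfolding runs_def
    by (intro exI[of _ "cost s e + 1"] exI[of _ s]) auto
next
  case (Cons y zs)
  have 1: "val s e \<noteq> Leaf" "cost s e < T'" "runs c s T' (I zs)" using assms(3)[OF Cons(2)] by auto
  obtain t s' where 2: "exec c s t s'" "t \<le> T'" "I zs s'" using 1(3) by (auto simp: runs_def)
  obtain u s'' where 3: "exec (While e c) s' u s''" "u \<le> 2 * T' * (length zs + 1)" "Q s''"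
    using Cons.IH[OF 2(3) order_refl] by (auto simp: runs_def)
  have "cost s e + 1 + t + u \<le> T"
    using 1(2) 2(2) 3(2) Cons.prems(2) by (simp add: algebra_simps)
  then show ?case using exec.WhileTrue[OF 1(1) 2(1) 3(1)] 3(3) unfolding runs_def by blast
qed

lemma tsize_val_le_cost: "tsize (val s e) \<le> cost s e"
  by (induction e) auto

text \<open>Writing a value costs at least its size. Hence polynomial time implies polynomial output
  size, as needed to compose bounds in \<open>pbound_ptime\<close>.\<close>

lemma exec_tsize: "exec c s t s' \<Longrightarrow> s' i = s i \<or> tsize (s' i) \<le> t"
proof (induction rule: exec.induct)
  case (Assign x e s)
  then show ?case using tsize_val_le_cost[of s e] by auto
qed auto

text \<open>
  Register \<open>b\<close> holds the argument and the result. The registers below \<open>b\<close> are preserved and those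
  above \<open>b\<close> are scratch space with arbitrary contents, so that programs can be nested by
  shifting \<open>b\<close>.
\<close>

definition implements :: "com \<Rightarrow> nat \<Rightarrow> ('a::enc \<Rightarrow> 'b::enc) \<Rightarrow> ('a \<Rightarrow> nat) \<Rightarrow> bool" where
  "implements c b f T \<longleftrightarrow> (\<forall>s x. s b = enc x \<longrightarrow>
     runs c s (T x) (\<lambda>s'. s' b = enc (f x) \<and> (\<forall>i<b. s' i = s i)))"

definition ptime :: "('a::enc \<Rightarrow> 'b::enc) \<Rightarrow> bool" where
  "ptime f \<longleftrightarrow> (\<exists>T. pbound T \<and> (\<forall>b. \<exists>c. implements c b f T))"

lemma ptimeD: "ptime f \<Longrightarrow> \<exists>T c. pbound T \<and> (\<forall>b. implements (c b) b f T)"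
  unfolding ptime_def by metis

lemma ptimeI: "pbound T \<Longrightarrow> (\<And>b. implements (c b) b f T) \<Longrightarrow> ptime f"
  unfolding ptime_def by blast

lemma implements_runs:
  "implements c b f T \<Longrightarrow> s b = enc x \<Longrightarrow>
    (\<And>s'. s' b = enc (f x) \<Longrightarrow> (\<And>i. i < b \<Longrightarrow> s' i = s i) \<Longrightarrow> Q s') \<Longrightarrow> runs c s (T x) Q"
  unfolding implements_def runs_def by blast

lemma pbound_ptime:
  assumes "ptime f"
  shows "pbound (\<lambda>x. sz (f x))"
proof -
  obtain T c where T: "pbound T" "\<And>b. implements (c b) b f T" using ptimeD[OF assms] by blast
  have "sz (f x) \<le> sz x + T x" for x
  proof -
    have "runs (c 0) (\<lambda>_. enc x) (T x) (\<lambda>s'. s' 0 = enc (f x))"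
      by (rule implements_runs[OF T(2)]) simp_all
    then obtain t s' where *: "exec (c 0) (\<lambda>_. enc x) t s'" "t \<le> T x" "s' 0 = enc (f x)"
      by (auto simp: runs_def)
    show ?thesis using exec_tsize[OF *(1), of 0] *(2,3) by (auto simp: sz_def)
  qed
  then show ?thesis by (rule pbound_mono[rotated]) (intro pbound_intros T(1))
qed

lemma ptime_polynomial_time_on:
  assumes "ptime F" "\<And>x. x \<in> D \<Longrightarrow> e x = enc (g x) \<and> e (f x) = enc (F (g x))"
  shows "polynomial_time_on D e f"
proof -
  obtain T c where T: "pbound T" "\<And>b. implements (c b) b F T" using ptimeD[OF assms(1)] by blast
  obtain p where p: "\<And>x. T x \<le> poly p (sz x)" using T(1) 
unfolding pbound_def by blast
  have "\<exists>t s. exec (c 0) ((\<lambda>_. Leaf)(0 := e x)) t s \<and> s 0 = e (f x) \<and> t \<le> poly p (tsize (e x))"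
    if "x \<in> D" for x
  proof -
    have "runs (c 0) ((\<lambda>_. Leaf)(0 := e x)) (T (g x)) (\<lambda>s'. s' 0 = enc (F (g x)))"
      by (rule implements_runs[OF T(2)]) (simp_all add: assms(2)[OF that])
    then show ?thesis unfolding runs_def
      using p[of "g x"] assms(2)[OF that] by (auto simp: sz_def intro: le_trans)
  qed
  then show ?thesis unfolding polynomial_time_on_def by blast
qed

lemma ptime_comp:
  fixes f :: "'a::enc \<Rightarrow> 'b::enc"
  assumes "ptime g" "ptime f"
  shows "ptime (\<lambda>x. g (f x))"
proof -
  obtain T c where T: "pbound T" "\<And>b. implements (c b) b f T" using ptimeD[OF assms(2)] by blast
  obtain U d where U: "pbound U" "\<And>b. implements (d b) b g U" using ptimeD[OF assms(1)] by blast
  show ?thesis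
  proof (rule ptimeI)
    show "pbound (\<lambda>x. T x + U (f x))"
      by (intro pbound_intros T pbound_comp[OF U(1)] pbound_ptime assms)
    show "implements (Seq (c b) (d b)) b (\<lambda>x. g (f x)) (\<lambda>x. T x + U (f x))" for b
      unfolding implements_def
    proof (intro allI impI)
      fix s and x :: 'a assume s: "s b = enc x"
      show "runs (Seq (c b) (d b)) s (T x + U (f x))
          (\<lambda>s'. s' b = enc (g (f x)) \<and> (\<forall>i<b. s' i = s i))"
      proof (rule runs_Seq[OF _ _ order_refl])
        show "runs (c b) s (T x) (\<lambda>s'. s' b = enc (f x) \<and> (\<forall>i<b. s' i = s i))"
          by (rule implements_runs[OF T(2)]) (auto simp: s)
        show "runs (d b) s' (U (f x)) (\<lambda>s'. s' b = enc (g (f x)) \<and> (\<forall>i<b. s' i = s i))"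
          if "s' b = enc (f x) \<and> (\<forall>i<b. s' i = s i)" for s'
          by (rule implements_runs[OF U(2)]) (use that in auto)
      qed
    qed
  qed
qed

text \<open>Types exist in HOL only: an operation that leaves the tree unchanged is the assignment
  of a register to itself. Cons, \<open>Suc\<close> and the passage between unary numbers and lists
  of units are all reduced to this case.\<close>

lemma ptime_same_enc:
  assumes "\<And>x. enc (f x) = enc x"
  shows "ptime f"
proof (rule ptimeI)
  show "pbound (\<lambda>x. sz x + 1)" by (intro pbound_intros)
  show "implements (Assign b (EVar b)) b f (\<lambda>x. sz x + 1)" for b
    unfolding implements_def by (intro allI impI runs_Assign) (auto simp: assms sz_def)
qed

lemma ptime_id: "ptime (\<lambda>x. x)"
  by (rule ptime_same_enc) simp

lemma ptime_const: "ptime (\<lambda>x. c)"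
proof -
  define E where "E = rec_tree ELeaf (\<lambda>l r. ENode)"
  have v: "val s (E t) = t" for s t
    by (induction t) (auto simp: E_def)
  have E: "cost s (E t) \<le> cost (\<lambda>_. Leaf) (E t)" for s t
    by (induction t) (use v in \<open>auto simp: E_def\<close>)
  show ?thesis
  proof (rule ptimeI)
    show "pbound (\<lambda>x. cost (\<lambda>_. Leaf) (E (enc c)) + 1)" by (intro pbound_intros)
    show "implements (Assign b (E (enc c))) b (\<lambda>x. c)
        (\<lambda>x. cost (\<lambda>_. Leaf) (E (enc c)) + 1)" for b
      unfolding implements_def by (intro allI impI runs_Assign) (simp_all add: v E)
  qed
qed

lemma ptime_fst0: "ptime (fst :: 'a::enc \<times> 'b::enc \<Rightarrow> 'a)"
proof (rule ptimeI)
  show "pbound (\<lambda>x :: 'a \<times> 'b. sz x + sz x + 1)" by (intro pbound_intros)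
  show "implements (Assign b (ELeft (EVar b))) b (fst :: 'a \<times> 'b \<Rightarrow> 'a) (\<lambda>x. sz x + sz x + 1)"
    for b unfolding implements_def by (intro allI impI runs_Assign) (auto simp: sz_def)
qed

lemma ptime_snd0: "ptime (snd :: 'a::enc \<times> 'b::enc \<Rightarrow> 'b)"
proof (rule ptimeI)
  show "pbound (\<lambda>x :: 'a \<times> 'b. sz x + sz x + 1)" by (intro pbound_intros)
  show "implements (Assign b (ERight (EVar b))) b (snd :: 'a \<times> 'b \<Rightarrow> 'b) (\<lambda>x. sz x + sz x + 1)"
    for b unfolding implements_def by (intro allI impI runs_Assign) (auto simp: sz_def)
qed

lemmas ptime_fst = ptime_comp[OF ptime_fst0]
lemmas ptime_snd = ptime_comp[OF ptime_snd0]

text \<open>With the projections, this lets the argument serve as an environment: free variables of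
  a term are projections, and a bound variable is one more component. Register \<open>b\<close>
  keeps the environment until both results are in \<open>b+1\<close> and \<open>b+2\<close>.\<close>

lemma ptime_Pair:
  fixes f :: "'a::enc \<Rightarrow> 'b::enc"
  assumes "ptime f" "ptime g"
  shows "ptime (\<lambda>x. (f x, g x))"
proof -
  obtain T c where T: "pbound T" "\<And>b. implements (c b) b f T" using ptimeD[OF assms(1)] by blast
  obtain U d where U: "pbound U" "\<And>b. implements (d b) b g U" using ptimeD[OF assms(2)] by blast
  define R where "R x = (sz x + 1) + (T x + ((sz x + 1) + (U x + (2 * (sz (f x) + sz (g x)) +
    2))))" for x
  show ?thesis
  proof (rule ptimeI)
    show "pbound R" unfolding R_def
      by (intro pbound_intros T U pbound_ptime assms)
    show "implements (Seq (Assign (b+1) (EVar b)) (Seq (c (b+1)) (Seq (Assign (b+2) (EVar b))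
      (Seq (d (b+2)) (Assign b (ENode (EVar (b+1)) (EVar (b+2)))))))) b (\<lambda>x. (f x, g x)) R" for b
      unfolding implements_def
    proof (intro allI impI)
      fix s and x :: 'a assume s: "s b = enc x"
      show "runs (Seq (Assign (b+1) (EVar b)) (Seq (c (b+1)) (Seq (Assign (b+2) (EVar b))
      (Seq (d (b+2)) (Assign b (ENode (EVar (b+1)) (EVar (b+2)))))))) s (R x)
        (\<lambda>s'. s' b = enc (f x, g x) \<and> (\<forall>i<b. s' i = s i))"
        unfolding R_def
        apply (rule runs_Assign_Seq[OF _ order_refl[THEN le_trans]])
         apply (rule runs_Seq[OF _ _ order_refl])
          apply (rule implements_runs[OF T(2),
            where Q = "\<lambda>s'. s' (b+1) = enc (f x) \<and> (\<forall>i\<le>b. s' i = s i)"])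
           apply (simp add: s)
          apply simp
         apply (rule runs_Assign_Seq[OF _ order_refl[THEN le_trans]])
          apply (rule runs_Seq[OF _ _ order_refl])
           apply (rule implements_runs[OF U(2),
             where Q = "\<lambda>s'. s' (b+2) = enc (g x) \<and> s' (b+1) = enc (f x) \<and> (\<forall>i\<le>b. s' i = s i)"])
            apply (simp add: s)
           apply simp
          apply (rule runs_Assign)
        apply (auto simp: s sz_def)
        done
    qed
  qed
qed

lemma ptime_comp2:
  assumes "ptime (\<lambda>p. h (fst p) (snd p))" "ptime f" "ptime g"
  shows "ptime (\<lambda>x. h (f x) (g x))"
  using ptime_comp[OF assms(1) ptime_Pair[OF assms(2,3)]] by simp

lemma ptime_if:
  fixes f :: "'a::enc \<Rightarrow> 'b::enc"
  assumes "ptime e" "ptime f" "ptime g"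
  shows "ptime (\<lambda>x. if e x then f x else g x)"
proof -
  obtain T c where T: "pbound T" "\<And>b. implements (c b) b e T" using ptimeD[OF assms(1)] by blast
  obtain U d where U: "pbound U" "\<And>b. implements (d b) b f U" using ptimeD[OF assms(2)] by blast
  obtain V k where V: "pbound V" "\<And>b. implements (k b) b g V" using ptimeD[OF assms(3)] by blast
  define R where "R x = (sz x + 1) + (T x + (sz (e x) + 1 + (U x + V x)))" for x
  show ?thesis
  proof (rule ptimeI)
    show "pbound R" unfolding R_def
      by (intro pbound_intros T U V pbound_ptime assms)
    show "implements (Seq (Assign (b+1) (EVar b)) (Seq (c (b+1)) (If (EVar (b+1)) (d b) (k b)))) b
      (\<lambda>x. if e x then f x else g x) R" for b
      unfolding implements_def
    proof (intro allI impI)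
      fix s and x :: 'a assume s: "s b = enc x"
      have U': "runs (d b) s' (U x + V x) (\<lambda>s'. s' b = enc (f x) \<and> (\<forall>i<b. s' i = s i))"
        if "\<forall>i\<le>b. s' i = s i" for s'
        using implements_runs[OF U(2)[of b], of s' x "\<lambda>s'. s' b = enc (f x) \<and>
          (\<forall>i<b. s' i = s i)"] that s
        unfolding runs_def by fastforce
      have V': "runs (k b) s' (U x + V x) (\<lambda>s'. s' b = enc (g x) \<and> (\<forall>i<b. s' i = s i))"
        if "\<forall>i\<le>b. s' i = s i" for s'
        using implements_runs[OF V(2)[of b], of s' x "\<lambda>s'. s' b = enc (g x) \<and>
          (\<forall>i<b. s' i = s i)"] that s
        unfolding runs_def by fastforce
      show "runs (Seq (Assign (b+1) (EVar b)) (Seq (c (b+1)) (If (EVar (b+1)) (d b) (k b)))) s (R x)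
        (\<lambda>s'. s' b = enc (if e x then f x else g x) \<and> (\<forall>i<b. s' i = s i))"
        unfolding R_def
        apply (rule runs_Assign_Seq[OF _ order_refl[THEN le_trans]])
         apply (rule runs_Seq[OF _ _ order_refl])
          apply (rule implements_runs[OF T(2),
            where Q = "\<lambda>s'. s' (b+1) = enc (e x) \<and> (\<forall>i\<le>b. s' i = s i)"])
           apply (simp add: s)
          apply simp
         apply (rule runs_If[where T' = "U x + V x"])
        apply (use U' V' in \<open>auto simp: s sz_def\<close>)
        done
    qed
  qed
qed

lemma ptime_case_list:
  fixes l :: "'a::enc \<Rightarrow> 'b::enc list"
  assumes "ptime l" "ptime f" "ptime (\<lambda>p. g (fst p) (fst (snd p)) (snd (snd p)))"
  shows "ptime (\<lambda>x. case l x of [] \<Rightarrow> f x | y # ys \<Rightarrow> g x y ys)"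
proof -
  let ?g = "\<lambda>p. g (fst p) (fst (snd p)) (snd (snd p))"
  obtain T c where T: "pbound T" "\<And>b. implements (c b) b l T" using ptimeD[OF assms(1)] by blast
  obtain U d where U: "pbound U" "\<And>b. implements (d b) b f U" using ptimeD[OF assms(2)] by blast
  obtain V k where V: "pbound V" "\<And>b. implements (k b) b ?g V" using ptimeD[OF assms(3)] by blast
  define j where "j x = (x, hd (l x), tl (l x))" for x
  \<comment> \<open>\<open>hd []\<close> is an unspecified value of unknown size, so the cost of the
    second branch may only be counted for nonempty lists.\<close>
  define W where "W x = U x + (if l x = [] then 0 else V (j x) + 2 * (sz x + sz (l x)) + 3)" for x
  define R where "R x = (sz x + 1) + (T x + (sz (l x) + 1 + W x))" for x
  obtain p where p: "\<And>y. V y \<le> poly p (sz y)" using V(1) 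
unfolding pbound_def by blast
  have "pbound (\<lambda>x. poly p (sz x + sz (l x) + 1))"
  proof -
    obtain q where q: "\<And>x. sz (l x) \<le> poly q (sz x)"
      using pbound_ptime[OF assms(1)] unfolding pbound_def by blast
    have "poly p (sz x + sz (l x) + 1) \<le> poly (pcompose p ([:1, 1:] + q)) (sz x)" for x
      using poly_nat_mono[of "sz x + sz (l x) + 1" "1 + sz x + poly q (sz x)" p] q[of x]
      by (simp add: poly_pcompose)
    then show ?thesis unfolding pbound_def by blast
  qed
  then have "pbound (\<lambda>x. U x + (poly p (sz x + sz (l x) + 1) + 2 * (sz x + sz (l x)) + 3))"
    by (intro pbound_intros U pbound_ptime assms)
  then have W: "pbound W"
  proof (rule pbound_mono)
    fix x
    have "V (j x) \<le> poly p (sz x + sz (l x) + 1)" if "l x \<noteq> []"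
      by (rule le_trans[OF p poly_nat_mono]) (use that in \<open>cases "l x"; auto simp: j_def\<close>)
    then show "W x \<le> U x + (poly p (sz x + sz (l x) + 1) + 2 * (sz x + sz (l x)) + 3)"
      by (auto simp: W_def)
  qed
  show ?thesis
  proof (rule ptimeI)
    show "pbound R" unfolding R_def
      by (intro pbound_intros T W pbound_ptime assms)
    show "implements (Seq (Assign (b+1) (EVar b)) (Seq (c (b+1)) (If (EVar (b+1))
       (Seq (Assign b (ENode (EVar b) (EVar (b+1)))) (k b)) (d b)))) b
      (\<lambda>x. case l x of [] \<Rightarrow> f x | y # ys \<Rightarrow> g x y ys) R" for b
      unfolding implements_def
    proof (intro allI impI)
      fix s and x :: 'a assume s: "s b = enc x"
      let ?Q = "\<lambda>s'. s' b = enc (case l x of [] \<Rightarrow> f x | y # ys \<Rightarrow> g x y ys) \<and> (\<forall>i<b. s' i = s i)"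
      have U': "runs (d b) s' (W x) ?Q" if "\<forall>i\<le>b. s' i = s i" "l x = []" for s'
        using implements_runs[OF U(2)[of b], of s' x ?Q] that s
        unfolding W_def by simp
      \<comment> \<open>The tree of a nonempty list is also the tree of the pair of its head and
        tail. Joining it to \<open>x\<close> therefore gives the triple that \<open>?g\<close>
        expects, without taking the list apart.\<close>
      have V': "runs (Seq (Assign b (ENode (EVar b) (EVar (b+1)))) (k b)) s' (W x) ?Q"
        if s': "\<forall>i\<le>b. s' i = s i" "s' (Suc b) = enc (l x)" and ne: "l x \<noteq> []" for s'
      proof (rule runs_Assign_Seq)
        show "runs (k b) (s'(b := val s' (ENode (EVar b) (EVar (b+1))))) (V (j x)) ?Q"
          by (rule implements_runs[OF V(2)])
            (use s s' ne in \<open>cases "l x"; auto simp: j_def\<close>)+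
        show "cost s' (ENode (EVar b) (EVar (b + 1))) + 1 + V (j x) \<le> W x"
          using s s' ne by (simp add: W_def sz_def)
      qed
      show "runs (Seq (Assign (b+1) (EVar b)) (Seq (c (b+1)) (If (EVar (b+1))
       (Seq (Assign b (ENode (EVar b) (EVar (b+1)))) (k b)) (d b)))) s (R x) ?Q"
        unfolding R_def
        apply (rule runs_Assign_Seq[OF _ order_refl[THEN le_trans]])
         apply (rule runs_Seq[OF _ _ order_refl])
          apply (rule implements_runs[OF T(2),
            where Q = "\<lambda>s'. s' (b+1) = enc (l x) \<and> (\<forall>i\<le>b. s' i = s i)"])
           apply (simp add: s)
          apply simp
         apply (rule runs_If[where T' = "W x"])
           apply (rule V'; force)
          apply (rule U'; (cases "l x"; force))
        apply (auto simp: s sz_def)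
        done
    qed
  qed
qed

text \<open>Iterating a polynomial-time step can double the accumulator in every round. The bound
  \<open>B\<close> on all intermediate accumulators excludes this, as in Cobham's bounded recursion
  on notation.\<close>

lemma ptime_foldl:
  fixes l :: "'a::enc \<Rightarrow> 'b::enc list"
  assumes "ptime l" "ptime i" "ptime (\<lambda>p. h (fst p) (fst (snd p)) (snd (snd p)))"
    and B: "pbound B" "\<And>x ys zs. l x = ys @ zs \<Longrightarrow> sz (foldl (h x) (i x) ys) \<le> B x"
  shows "ptime (\<lambda>x. foldl (h x) (i x) (l x))"
proof -
  let ?h = "\<lambda>p. h (fst p) (fst (snd p)) (snd (snd p))"
  obtain T c where T: "pbound T" "\<And>b. implements (c b) b l T" using ptimeD[OF assms(1)] by blast
  obtain U d where U: "pbound U" "\<And>b. implements (d b) b i U" using ptimeD[OF assms(2)] by blast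
  obtain V k where V: "pbound V" "\<And>b. implements (k b) b ?h V" using ptimeD[OF assms(3)] by blast
  obtain p where p: "\<And>y. V y \<le> poly p (sz y)" using V(1) 
unfolding pbound_def by blast
  define S where "S x = sz x + B x + sz (l x) + 2" for x
  have S: "pbound S" unfolding S_def by (intro pbound_intros B pbound_ptime assms)
  \<comment> \<open>For one round: at most 4 times \<open>S x\<close> for building the triple, once
    for copying the new accumulator, twice for taking the tail, and \<open>poly p (S x)\<close> for
    the step function.\<close>
  define W where "W x = 7 * S x + 5 + poly p (S x)" for x
  have "pbound (\<lambda>x. poly p (S x))"
  proof -
    obtain q where q: "\<And>x. S x \<le> poly q (sz x)" using S 
unfolding pbound_def by blast
    have "poly p (S x) \<le> poly (pcompose p q) (sz x)" for x
      using poly_nat_mono[OF q, of p] by (simp add: poly_pcompose)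
    then show ?thesis unfolding pbound_def by blast
  qed
  then have W: "pbound W" unfolding W_def by (intro pbound_intros S)
  \<comment> \<open>Register \<open>b\<close> holds the argument, \<open>b+1\<close> the rest of the
    list and \<open>b+2\<close> the accumulator; the step function works from \<open>b+3\<close>
    upwards and so cannot disturb them.\<close>
  define body where "body b = Seq (Assign (b+3) (ENode (EVar b) (ENode (EVar (b+2)) (ELeft (EVar
    (b+1))))))
    (Seq (k (b+3)) (Seq (Assign (b+2) (EVar (b+3))) (Assign (b+1) (ERight (EVar (b+1))))))" for b
  define prog where "prog b = Seq (Assign (b+1) (EVar b)) (Seq (c (b+1)) (Seq (Assign (b+2) (EVar
    b))
    (Seq (d (b+2)) (Seq (While (EVar (b+1)) (body b)) (Assign b (EVar (b+2)))))))" for b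
  define R where "R x = (sz x + 1) + (T x + ((sz x + 1) + (U x + (2 * W x * (sz (l x) + 1) +
    (B x + 1)))))" for x
  show ?thesis
  proof (rule ptimeI)
    show "pbound R" unfolding R_def
      by (intro pbound_intros T U W B pbound_ptime assms)
    show "implements (prog b) b (\<lambda>x. foldl (h x) (i x) (l x)) R" for b
      unfolding implements_def
    proof (intro allI impI)
      fix s and x :: 'a assume s: "s b = enc x"
      define I where "I zs s' \<longleftrightarrow> (\<forall>i\<le>b. s' i = s i) \<and> s' (b+1) = enc zs \<and>
        (\<exists>ys. l x = ys @ zs \<and> s' (b+2) = enc (foldl (h x) (i x) ys))" for zs s'
      have loop: "runs (While (EVar (b+1)) (body b)) s' (2 * W x * (sz (l x) + 1))
          (\<lambda>s'. s' (b+2) = enc (foldl (h x) (i x) (l x)) \<and> (\<forall>i\<le>b. s' i = s i))"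
        if "I (l x) s'" for s'
      proof (rule runs_While_list[where I = I and ys = "l x" and T' = "W x"])
        show "I (l x) s'" by (rule that)
        show "2 * W x * (length (l x) + 1) \<le> 2 * W x * (sz (l x) + 1)"
          using length_le_sz by (intro mult_left_mono) auto
        have sub: "sz zs \<le> sz (l x)" if "l x = ys @ zs" for ys zs
          using sz_append[of ys zs] that sz_pos[of ys] by simp
        show "val s' (EVar (b+1)) = Leaf \<and> cost s' (EVar (b+1)) < W x \<and>
            s' (b+2) = enc (foldl (h x) (i x) (l x)) \<and> (\<forall>i\<le>b. s' i = s i)" if "I [] s'" for s'
          using that by (auto simp: I_def W_def)
        show "val s' (EVar (b+1)) \<noteq> Leaf \<and> cost s' (EVar (b+1)) < W x \<and>
          runs (body b) s' (W x) (I zs)"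
          if inv: "I (y # zs) s'" for s' y zs
        proof -
          obtain ys where ys: "l x = ys @ y # zs" "s' (b+2) = enc (foldl (h x) (i x) ys)"
            and s': "\<And>i. i \<le> b \<Longrightarrow> s' i = s i" "s' (b+1) = enc (y # zs)"
            using inv unfolding I_def by blast
          define a where "a = foldl (h x) (i x) ys"
          have a: "sz a \<le> B x" using B(2)[OF ys(1)] by (simp add: a_def)
          have ha: "sz (h x a y) \<le> B x" using B(2)[of x "ys @ [y]" zs] ys(1) by (simp add: a_def)
          have yz: "sz y + sz zs + 1 \<le> sz (l x)" using sub[OF ys(1)] by simp
          have "runs (body b) s' ((4 * S x + 1) + (V (x, a, y) + ((B x + 1) + (2 * S x +
            1)))) (I zs)"
            unfolding body_def
            apply (rule runs_Assign_Seq[OF _ order_refl[THEN le_trans]])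
             apply (rule runs_Seq[OF _ _ order_refl])
              apply (rule implements_runs[OF V(2), where x = "(x, a, y)"
                and Q = "\<lambda>s''. s'' (b+3) = enc (h x a y) \<and> (\<forall>i<b+3. s'' i = s' i)"])
               apply (use s' ys in \<open>simp add: s a_def\<close>)
              apply simp
             apply (rule runs_Assign_Seq[OF _ order_refl[THEN le_trans]])
              apply (rule runs_Assign)
            unfolding I_def
               apply (intro conjI exI[of _ "ys @ [y]"])
            using s' ys yz a ha
            by (auto simp: s a_def sz_def S_def)
          moreover have "(4 * S x + 1) + (V (x, a, y) + ((B x + 1) + (2 * S x + 1))) \<le> W x"
          proof -
            have "V (x, a, y) \<le> poly p (S x)"
              by (rule le_trans[OF p poly_nat_mono]) (use a yz in \<open>simp add: S_def\<close>)
            then show ?thesis by (simp add: W_def S_def)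
          qed
          ultimately have "runs (body b) s' (W x) (I zs)" unfolding runs_def by (meson le_trans)
          then show ?thesis using s' yz by (auto simp: W_def sz_def S_def)
        qed
      qed
      show "runs (prog b) s (R x) (\<lambda>s'. s' b = enc (foldl (h x) (i x) (l x)) \<and> (\<forall>i<b. s' i = s i))"
        unfolding R_def prog_def
        apply (rule runs_Assign_Seq[OF _ order_refl[THEN le_trans]])
         apply (rule runs_Seq[OF _ _ order_refl])
          apply (rule implements_runs[OF T(2),
            where Q = "\<lambda>s'. s' (b+1) = enc (l x) \<and> (\<forall>i\<le>b. s' i = s i)"])
           apply (simp add: s)
          apply simp
         apply (rule runs_Assign_Seq[OF _ order_refl[THEN le_trans]])
          apply (rule runs_Seq[OF _ _ order_refl])
           apply (rule implements_runs[OF U(2),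
             where Q = "\<lambda>s'. s' (b+2) = enc (i x) \<and> s' (b+1) = enc (l x) \<and> (\<forall>i\<le>b. s' i = s i)"])
            apply (simp add: s)
           apply simp
          apply (rule runs_Seq[OF _ _ order_refl])
           apply (rule loop)
           apply (simp add: I_def)
          apply (rule runs_Assign)
        using B(2)[of x "l x" "[]"]
           apply (auto simp: s sz_def)
        done
    qed
  qed
qed

section \<open>Closure of polynomial time under list operations and unary arithmetic\<close>

named_theorems ptime_intros

lemmas [ptime_intros] = ptime_id ptime_const ptime_fst ptime_snd ptime_Pair ptime_if ptime_case_list

text \<open>An element is no larger than its list, so a bound in the environment and an element
  turns into a bound in the environment alone.\<close>

lemma pbound_elem:
  assumes "pbound G" "ptime l"
  obtains q where "pbound q" "\<And>x y. y \<in> set (l x) \<Longrightarrow> G (x, y) \<le> q x"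
proof -
  obtain p where p: "\<And>z. G z \<le> poly p (sz z)" using assms(1) unfolding pbound_def by blast
  obtain r where r: "\<And>x. sz (l x) \<le> poly r (sz x)"
    using pbound_ptime[OF assms(2)] unfolding pbound_def by blast
  define q where "q x = poly (pcompose p ([:1, 1:] + r)) (sz x)" for x :: 'a
  show ?thesis
  proof (rule that)
    show "pbound q" unfolding pbound_def q_def by blast
    show "G (x, y) \<le> q x" if "y \<in> set (l x)" for x y
      unfolding q_def poly_pcompose
      by (rule le_trans[OF p poly_nat_mono]) (use sz_elem[OF that] r[of x] in simp)
  qed
qed

text \<open>Growth by an amount independent of the accumulator adds up to at most
  \<open>sz (l x) * q x\<close>, since a list has no more entries than its size. Most loops of the
  algorithm are of this kind.\<close>

lemma ptime_foldl_add:
  fixes l :: "'a::enc \<Rightarrow> 'b::enc list"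
  assumes "ptime l" "ptime i" "ptime (\<lambda>p. h (fst p) (fst (snd p)) (snd (snd p)))"
    and q: "pbound q" "\<And>x a y. y \<in> set (l x) \<Longrightarrow> sz (h x a y) \<le> sz a + q x"
  shows "ptime (\<lambda>x. foldl (h x) (i x) (l x))"
proof (rule ptime_foldl[OF assms(1-3)])
  show "pbound (\<lambda>x. sz (i x) + sz (l x) * q x)" by (intro pbound_intros pbound_ptime assms)
  fix x ys zs assume l: "l x = ys @ zs"
  have "sz (foldl (h x) (i x) ys) \<le> sz (i x) + length ys * q x"
    if "set ys \<subseteq> set (l x)" for ys using that
  proof (induction ys rule: rev_induct)
    case (snoc y ys)
    then show ?case using q(2)[of y x "foldl (h x) (i x) ys"] by simp
  qed simp
  moreover have "length ys \<le> sz (l x)" using length_le_sz[of "l x"] l by simp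
  ultimately show "sz (foldl (h x) (i x) ys) \<le> sz (i x) + sz (l x) * q x"
    using l by (fastforce intro: le_trans)
qed

lemma ptime_Cons [ptime_intros]: "ptime f \<Longrightarrow> ptime g \<Longrightarrow> ptime (\<lambda>x. f x # g x)"
  by (rule ptime_comp2[where h = "(#)"], rule ptime_same_enc) (simp add: enc_prod_def)

lemma foldl_Cons: "foldl (\<lambda>a y. f y # a) as xs = rev (map f xs) @ as"
  by (induction xs arbitrary: as) auto

lemma ptime_rev [ptime_intros]:
  assumes "ptime l"
  shows "ptime (\<lambda>x. rev (l x))"
proof (rule ptime_comp[OF _ assms])
  have "ptime (\<lambda>l :: 'b list. foldl (\<lambda>a y. y # a) [] l)"
    by (rule ptime_foldl_add[where q = "\<lambda>x. sz x + 1"])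
      (use sz_elem in \<open>auto intro!: ptime_intros pbound_intros\<close>)
  then show "ptime (rev :: 'b list \<Rightarrow> _)" by (simp add: foldl_Cons[of "\<lambda>x. x", simplified])
qed

lemma ptime_map [ptime_intros]:
  assumes "ptime l" "ptime (\<lambda>p. h (fst p) (snd p))"
  shows "ptime (\<lambda>x. map (h x) (l x))"
proof -
  obtain q where q: "pbound q" "\<And>x y. y \<in> set (l x) \<Longrightarrow> sz (h x y) \<le> q x"
    using pbound_elem[OF pbound_ptime[OF assms(2)] assms(1)] by auto
  have "ptime (\<lambda>x. foldl (\<lambda>a y. h x y # a) [] (l x))"
    by (rule ptime_foldl_add[where q = "\<lambda>x. q x + 1"])
      (use q in \<open>auto intro!: ptime_intros pbound_intros ptime_comp2[OF assms(2)] assms\<close>)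
  from ptime_rev[OF this] show ?thesis by (simp add: foldl_Cons)
qed

lemma ptime_filter [ptime_intros]:
  assumes "ptime l" "ptime (\<lambda>p. P (fst p) (snd p))"
  shows "ptime (\<lambda>x. filter (P x) (l x))"
proof -
  have "ptime (\<lambda>x. foldl (\<lambda>a y. if P x y then y # a else a) [] (l x))"
    by (rule ptime_foldl_add[where q = "\<lambda>x. sz (l x) + 1"])
      (use sz_elem in \<open>auto intro!: ptime_intros pbound_intros pbound_ptime ptime_comp2[OF
        assms(2)] assms\<close>)
  moreover have "foldl (\<lambda>a y. if P x y then y # a else a) as ys = rev (filter (P x) ys) @ as"
    for x as ys
    by (induction ys arbitrary: as) auto
  ultimately have "ptime (\<lambda>x. rev (filter (P x) (l x)))" by simp
  from ptime_rev[OF this] show ?thesis by simp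
qed

lemma ptime_append [ptime_intros]:
  assumes "ptime f" "ptime g"
  shows "ptime (\<lambda>x. f x @ g x)"
proof -
  have "ptime (\<lambda>x. foldl (\<lambda>a y. y # a) (g x) (rev (f x)))"
    by (rule ptime_foldl_add[where q = "\<lambda>x. sz (f x) + 1"])
      (use sz_elem in \<open>auto intro!: ptime_intros pbound_intros pbound_ptime assms\<close>)
  then show ?thesis by (simp add: foldl_Cons[of "\<lambda>x. x", simplified])
qed

lemma ptime_concat [ptime_intros]:
  assumes "ptime f"
  shows "ptime (\<lambda>x. concat (f x))"
proof -
  have "sz (a @ y) \<le> sz a + sz (f x)" if "y \<in> set (f x)" for x a y
    using sz_append[of a y] sz_elem[OF that] by simp
  then have "ptime (\<lambda>x. foldl (\<lambda>a y. a @ y) [] (f x))"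
    by (intro ptime_foldl_add[where q = "\<lambda>x. sz (f x)"])
      (auto intro!: ptime_intros pbound_intros pbound_ptime assms)
  moreover have "foldl (\<lambda>a y. a @ y) as xs = as @ concat xs" for as and xs :: "'b list list"
    by (induction xs arbitrary: as) auto
  ultimately show ?thesis by simp
qed

lemma ptime_not [ptime_intros]:
  assumes "ptime f"
  shows "ptime (\<lambda>x. \<not> f x)"
proof -
  have "ptime (\<lambda>x. if f x then False else True)" by (intro ptime_if ptime_const assms)
  then show ?thesis by (rule back_subst[of ptime]) auto
qed

lemma ptime_conj [ptime_intros]:
  assumes "ptime f" "ptime g"
  shows "ptime (\<lambda>x. f x \<and> g x)"
proof -
  have "ptime (\<lambda>x. if f x then g x else False)" by (intro ptime_if ptime_const assms)
  then show ?thesis by (rule back_subst[of ptime]) auto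
qed

lemma ptime_disj [ptime_intros]:
  assumes "ptime f" "ptime g"
  shows "ptime (\<lambda>x. f x \<or> g x)"
proof -
  have "ptime (\<lambda>x. if f x then True else g x)" by (intro ptime_if ptime_const assms)
  then show ?thesis by (rule back_subst[of ptime]) auto
qed

lemma ptime_imp [ptime_intros]:
  assumes "ptime f" "ptime g"
  shows "ptime (\<lambda>x. f x \<longrightarrow> g x)"
proof -
  have "ptime (\<lambda>x. if f x then g x else True)" by (intro ptime_if ptime_const assms)
  then show ?thesis by (rule back_subst[of ptime]) auto
qed

lemma ptime_eq_bool [ptime_intros]:
  assumes "ptime f" "ptime g"
  shows "ptime (\<lambda>x. f x = (g x :: bool))"
proof -
  have "ptime (\<lambda>x. if f x then g x else if g x then False else True)"
    by (intro ptime_if ptime_const assms)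
  then show ?thesis by (rule back_subst[of ptime]) auto
qed

lemma ptime_eq_Nil [ptime_intros]:
  assumes "ptime f"
  shows "ptime (\<lambda>x. f x = [])"
proof -
  have "ptime (\<lambda>x. case f x of [] \<Rightarrow> True | y # ys \<Rightarrow> False)"
    by (intro ptime_intros assms)
  then show ?thesis by (rule back_subst[of ptime]) (auto simp: fun_eq_iff split: list.split)
qed

lemma ptime_Ball [ptime_intros]:
  assumes "ptime l" "ptime (\<lambda>p. P (fst p) (snd p))"
  shows "ptime (\<lambda>x. \<forall>y \<in> set (l x). P x y)"
  using ptime_eq_Nil[OF ptime_filter[OF assms(1) ptime_not[OF assms(2)]]]
  by (simp add: filter_empty_conv)

lemma ptime_Bex [ptime_intros]:
  assumes "ptime l" "ptime (\<lambda>p. P (fst p) (snd p))"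
  shows "ptime (\<lambda>x. \<exists>y \<in> set (l x). P x y)"
  using ptime_not[OF ptime_Ball[OF assms(1) ptime_not[OF assms(2)]]] by simp

lemma ptime_Suc [ptime_intros]:
  assumes "ptime f"
  shows "ptime (\<lambda>x. Suc (f x))"
proof -
  have "ptime (\<lambda>p :: unit \<times> nat. Suc (snd p))"
    by (rule ptime_same_enc) (simp add: enc_prod_def enc_nat_def)
  from ptime_comp[OF this, of "\<lambda>x. ((), f x)"] show ?thesis by (simp add: ptime_intros assms)
qed

lemma ptime_length [ptime_intros]:
  assumes "ptime f"
  shows "ptime (\<lambda>x. length (f x))"
proof -
  have "ptime (length :: unit list \<Rightarrow> nat)"
    by (rule ptime_same_enc) (simp add: enc_nat_def replicate_length_same)
  from ptime_comp[OF this, of "\<lambda>x. map (\<lambda>_. ()) (f x)"] show ?thesis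
    by (simp add: ptime_intros assms)
qed

lemma ptime_replicate_unit [ptime_intros]: "ptime f \<Longrightarrow> ptime (\<lambda>x. replicate (f x) ())"
  by (rule ptime_comp[of "\<lambda>n. replicate n ()"], rule ptime_same_enc) (simp_all add: enc_nat_def)

lemma ptime_tl [ptime_intros]:
  assumes "ptime f"
  shows "ptime (\<lambda>x. tl (f x))"
proof -
  have "ptime (\<lambda>x. case f x of [] \<Rightarrow> [] | y # ys \<Rightarrow> ys)" by (intro ptime_intros assms)
  then show ?thesis by (rule back_subst[of ptime]) (auto split: list.split)
qed

lemma ptime_drop [ptime_intros]:
  assumes "ptime f" "ptime g"
  shows "ptime (\<lambda>x. drop (f x) (g x))"
proof -
  have tl: "sz (tl a) \<le> sz a + 0" for a :: "'b list" by (cases a) auto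
  have "ptime (\<lambda>x. foldl (\<lambda>a y. tl a) (g x) (replicate (f x) ()))"
    by (rule ptime_foldl_add[where q = "\<lambda>x. 0"])
      (use tl in \<open>auto intro!: ptime_intros pbound_intros assms\<close>)
  moreover have "foldl (\<lambda>a y. tl a) xs (replicate n ()) = drop n xs" for n and xs :: "'b list"
    by (induction n arbitrary: xs) (auto simp: drop_Suc tl_drop)
  ultimately show ?thesis by simp
qed

text \<open>In unary, truncated subtraction is \<open>drop\<close>; the comparisons below reduce to
  it.\<close>

lemma ptime_minus [ptime_intros]:
  assumes "ptime f" "ptime g"
  shows "ptime (\<lambda>x. f x - (g x :: nat))"
proof -
  have "ptime (\<lambda>x. length (drop (g x) (replicate (f x) ())))" by (intro ptime_intros assms)
  then show ?thesis by simp
qed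

lemma ptime_le [ptime_intros]:
  assumes "ptime f" "ptime g"
  shows "ptime (\<lambda>x. f x \<le> (g x :: nat))"
proof -
  have "ptime (\<lambda>x. replicate (f x - g x) () = [])" by (intro ptime_intros assms)
  then show ?thesis by simp
qed

lemma ptime_less [ptime_intros]: "ptime f \<Longrightarrow> ptime g \<Longrightarrow> ptime (\<lambda>x. f x < (g x :: nat))"
  unfolding Suc_le_eq[symmetric] by (intro ptime_intros)

lemma ptime_eq_nat [ptime_intros]: "ptime f \<Longrightarrow> ptime g \<Longrightarrow> ptime (\<lambda>x. f x = (g x :: nat))"
  unfolding eq_iff by (intro ptime_intros)

text \<open>The new entry is the length of the accumulator, so \<open>ptime_foldl_add\<close> does
  not apply. But the accumulator is known exactly: a reversed interval of at most \<open>f x\<close>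
  numbers, each of size at most \<open>2 * f x + 1\<close>.\<close>

lemma ptime_upt [ptime_intros]:
  assumes "ptime f"
  shows "ptime (\<lambda>x. [0..<f x])"
proof -
  have *: "foldl (\<lambda>a y. length a # a) [] us = rev [0..<length us]" for us :: "unit list"
    by (induction us rule: rev_induct) auto
  have "sz (rev [0..<length ys]) \<le> f x * (2 * f x + 2) + 1"
    if "replicate (f x) () = ys @ zs" for x ys zs
  proof -
    have "length ys + length zs = f x" using arg_cong[OF that, of length] by simp
    then have "length ys \<le> f x" by simp
    moreover from this have "sz (rev [0..<length ys]) \<le> length ys * (2 * f x + 1 + 1) + 1"
      using sz_list_le[of "rev [0..<length ys]" "2 * f x + 1"] by (simp add: sz_nat)
    moreover have "length ys * (2 * f x + 1 + 1) \<le> f x * (2 * f x + 2)"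
      using mult_le_mono[OF \<open>length ys \<le> f x\<close> order_refl[of "2 * f x + 2"]] by simp
    ultimately show ?thesis by linarith
  qed
  moreover have "pbound (\<lambda>x. f x)"
    by (rule pbound_mono[OF pbound_ptime[OF assms]]) (simp add: sz_nat)
  ultimately have "ptime (\<lambda>x. foldl (\<lambda>a y. length a # a) [] (replicate (f x) ()))"
    by (intro ptime_foldl[where B = "\<lambda>x. f x * (2 * f x + 2) + 1"])
      (auto simp: * intro!: ptime_intros pbound_intros assms)
  from ptime_rev[OF this] show ?thesis by (simp add: *)
qed

section \<open>The algorithm\<close>

text \<open>A total form of \<open>M ! u ! v\<close> that is False out of range, built from
  \<open>drop\<close> and case distinctions because these have rules for polynomial time.\<close>

definition entry :: "bool list list \<Rightarrow> nat \<Rightarrow> nat \<Rightarrow> bool" where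
  "entry M u v = (case drop u M of [] \<Rightarrow> False | r # _ \<Rightarrow> case drop v r of [] \<Rightarrow> False | b # _ \<Rightarrow> b)"

definition expand :: "bool list list \<Rightarrow> nat \<Rightarrow> nat \<Rightarrow> nat list \<Rightarrow> nat list" where
  "expand M u v R = filter (\<lambda>w. \<exists>z\<in>set R. z = w \<or>
     entry M z w \<and> \<not> (z = u \<and> w = v) \<and> \<not> (z = v \<and> w = u)) [0..<length M]"

text \<open>The list \<open>concat M\<close> only serves as a counter: it is long enough for the search to stabilise.\<close>

definition reach :: "bool list list \<Rightarrow> nat \<Rightarrow> nat \<Rightarrow> nat list" where
  "reach M u v = foldl (\<lambda>R _. expand M u v R) [u] (concat M)"

definition nonbridges :: "bool list list \<Rightarrow> bool list list" where
  "nonbridges M = map (\<lambda>u. map (\<lambda>v. entry M u v \<and> (\<exists>w\<in>set (reach M u v). w = v))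
     [0..<length M]) [0..<length M]"

text \<open>
  The state of the auction is the log of all bids \<open>(u, v)\<close>, the latest first. A bid for \<open>v\<close> raises
  the price of \<open>v\<close> by 1 and evicts the previous owner.
\<close>

definition price :: "(nat \<times> nat) list \<Rightarrow> nat \<Rightarrow> nat" where
  "price L v = length (filter (\<lambda>e. snd e = v) L)"

definition owns :: "(nat \<times> nat) list \<Rightarrow> nat \<Rightarrow> nat \<Rightarrow> bool" where
  "owns L u v = (case filter (\<lambda>e. snd e = v) L of [] \<Rightarrow> False | e # _ \<Rightarrow> fst e = u)"

definition bid_ok :: "bool list list \<Rightarrow> (nat \<times> nat) list \<Rightarrow> nat \<times> nat \<Rightarrow> bool" where
  "bid_ok N L e \<longleftrightarrow> entry N (fst e) (snd e) \<and> price L (snd e) \<le> length N \<and>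
     (\<forall>w\<in>set [0..<length N]. \<not> owns L (fst e) w \<and>
       (entry N (fst e) w \<longrightarrow> price L (snd e) \<le> price L w))"

definition pairs :: "nat \<Rightarrow> (nat \<times> nat) list" where
  "pairs n = concat (map (\<lambda>u. map (\<lambda>v. (u, v)) [0..<n]) [0..<n])"

definition bid :: "bool list list \<Rightarrow> (nat \<times> nat) list \<Rightarrow> (nat \<times> nat) list" where
  "bid N L = (case filter (bid_ok N L) (pairs (length N)) of [] \<Rightarrow> L | e # _ \<Rightarrow> e # L)"

text \<open>The list is a counter of (n + 1)^2 rounds, more than the number of bids that the prices
  permit.\<close>

definition auction :: "bool list list \<Rightarrow> (nat \<times> nat) list" where
  "auction N = foldl (\<lambda>L _. bid N L) [] (pairs (Suc (length N)))"

text \<open>There are n + 1 candidate levels and only n prices, so the filtered list is nonempty and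
  the default 0 never arises.\<close>

definition gap :: "nat \<Rightarrow> (nat \<times> nat) list \<Rightarrow> nat" where
  "gap n L = (case filter (\<lambda>l. \<forall>v\<in>set [0..<n]. price L v \<noteq> l) (map Suc [0..<Suc n]) of
     [] \<Rightarrow> 0 | l # _ \<Rightarrow> l)"

text \<open>
  \<open>(v, False)\<close> and \<open>(v, True)\<close> are the left and the right copy of \<open>v\<close> in the double cover.
  The pair \<open>(length N, False)\<close>, which is no such copy, will be the universal vertex of the kernel.
\<close>

definition cover_of :: "nat \<Rightarrow> (nat \<times> nat) list \<Rightarrow> nat \<Rightarrow> (nat \<times> bool) list" where
  "cover_of n L l =
     map (\<lambda>u. (u, False)) (filter (\<lambda>u. \<exists>v\<in>set [0..<n]. owns L u v \<and> price L v < l) [0..<n]) @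
     map (\<lambda>v. (v, True)) (filter (\<lambda>v. l < price L v) [0..<n])"

definition cover :: "bool list list \<Rightarrow> (nat \<times> bool) list" where
  "cover N = cover_of (length N) (auction N) (gap (length N) (auction N))"

definition half :: "(nat \<times> bool) list \<Rightarrow> nat \<Rightarrow> bool" where
  "half C v \<longleftrightarrow> (\<exists>c\<in>set C. fst c = v \<and> snd c) \<noteq> (\<exists>c\<in>set C. fst c = v \<and> \<not> snd c)"

text \<open>If both copies of a vertex are in \<open>C\<close>, its only edges apart from those to
  the root are the one between these copies: that edge alone makes a cover pay one unit for the
  vertex, and the vertex then covers all its original edges. Original edges are kept only between
  vertices with exactly one copy in \<open>C\<close>.\<close>

definition link :: "bool list list \<Rightarrow> (nat \<times> bool) list \<Rightarrow> nat \<times> bool \<Rightarrow> nat \<times> bool \<Rightarrow> bool" where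
  "link N C a b = (if fst a = fst b then snd a \<noteq> snd b
     else fst a = length N \<or> fst b = length N \<or>
       half C (fst a) \<and> half C (fst b) \<and> entry N (fst a) (fst b))"

definition kernel_matrix :: "bool list list \<Rightarrow> (nat \<times> bool) list \<Rightarrow> bool list list" where
  "kernel_matrix N C = map (\<lambda>a. map (link N C a) ((length N, False) # C)) ((length N, False) # C)"

text \<open>
  \<open>ripple True\<close> adds 1 to a binary number and \<open>ripple False\<close> subtracts 1, both modulo a power of 2;
  the digits are returned in reverse, preceded by the final carry.
\<close>

definition ripple :: "bool \<Rightarrow> bool list \<Rightarrow> bool \<times> bool list" where
  "ripple d bs = foldl (\<lambda>a b. (fst a \<and> b = d, (fst a \<noteq> b) # snd a)) (True, []) bs"

definition incr :: "bool list \<Rightarrow> bool list" where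
  "incr bs = rev (if fst (ripple True bs) then True # snd (ripple True bs) else snd (ripple True
    bs))"

text \<open>Compares a unary length with a binary number: one is subtracted per list element, and
  the flag stays True as long as no subtraction has underflowed.\<close>

definition countdown :: "'a list \<Rightarrow> bool list \<Rightarrow> bool \<times> bool list" where
  "countdown xs bs = foldl (\<lambda>a _. (fst a \<and>
    \<not> fst (ripple False (snd a)), rev (snd (ripple False (snd a)))))
     (True, bs) xs"

text \<open>The least significant digit comes first, so the False in front doubles the number: the
  test is |C| \<le> 2k. The alternative output is the triangle with the empty expansion, that is,
  budget 0.\<close>

definition kernel :: "bool list list \<times> bool list \<Rightarrow> bool list list \<times> bool list" where
  "kernel x =
     (if fst (countdown (cover (nonbridges (fst x))) (False # snd x))
      then (kernel_matrix (nonbridges (fst x)) (cover (nonbridges (fst x))), incr (snd x))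
      else ([[False, True, True], [True, False, True], [True, True, False]], []))"

section \<open>Running time of the algorithm\<close>

lemma ptime_comp3:
  assumes "ptime (\<lambda>p. h (fst p) (fst (snd p)) (snd (snd p)))" "ptime f" "ptime g" "ptime k"
  shows "ptime (\<lambda>x. h (f x) (g x) (k x))"
  using ptime_comp[OF assms(1) ptime_Pair[OF assms(2) ptime_Pair[OF assms(3,4)]]] by simp

lemma ptime_entry [ptime_intros]:
  "ptime f \<Longrightarrow> ptime g \<Longrightarrow> ptime h \<Longrightarrow> ptime (\<lambda>x. entry (f x) (g x) (h x))"
  by (rule ptime_comp3) (unfold entry_def, intro ptime_intros)

lemma sz_filter: "sz (filter P xs) \<le> sz xs"
  by (induction xs) auto

lemma ptime_expand:
  "ptime (\<lambda>p. expand (fst p) (fst (fst (snd p))) (snd (fst (snd p))) (snd (snd p)))"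
  unfolding expand_def by (intro ptime_intros)

lemma ptime_reach [ptime_intros]:
  assumes "ptime f" "ptime g" "ptime h"
  shows "ptime (\<lambda>x. reach (f x) (g x) (h x))"
proof (rule ptime_comp3[OF _ assms])
  show "ptime (\<lambda>p. reach (fst p) (fst (snd p)) (snd (snd p)))"
    unfolding reach_def
  proof (rule ptime_foldl_add)
    show "ptime (\<lambda>p. expand (fst (fst p)) (fst (snd (fst p))) (snd (snd (fst p))) (fst (snd p)))"
      using ptime_comp3[OF ptime_expand, of "\<lambda>p. fst (fst p)" "\<lambda>p. snd (fst p)" "\<lambda>p. fst (snd p)"]
      by (simp add: ptime_intros)
    show "pbound (\<lambda>p. sz [0..<length (fst p)])"
      by (intro pbound_ptime ptime_intros)
    \<comment> \<open>Whatever the old list was, the new one is a filtered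
      \<open>[0..<length M]\<close>.\<close>
    show "sz (expand M u v R) \<le> sz a + sz [0..<length M]" for M u v R and a :: "nat list"
      unfolding expand_def by (rule trans_le_add2[OF sz_filter])
  qed (intro ptime_intros)+
qed

lemma ptime_nonbridges [ptime_intros]: "ptime f \<Longrightarrow> ptime (\<lambda>x. nonbridges (f x))"
  by (rule ptime_comp) (unfold nonbridges_def, intro ptime_intros)

lemma ptime_price [ptime_intros]: "ptime f \<Longrightarrow> ptime g \<Longrightarrow> ptime (\<lambda>x. price (f x) (g x))"
  by (rule ptime_comp2) (unfold price_def, intro ptime_intros)

lemma ptime_owns [ptime_intros]:
  "ptime f \<Longrightarrow> ptime g \<Longrightarrow> ptime h \<Longrightarrow> ptime (\<lambda>x. owns (f x) (g x) (h x))"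
  by (rule ptime_comp3) (unfold owns_def, intro ptime_intros)

lemma ptime_bid_ok [ptime_intros]:
  "ptime f \<Longrightarrow> ptime g \<Longrightarrow> ptime h \<Longrightarrow> ptime (\<lambda>x. bid_ok (f x) (g x) (h x))"
  by (rule ptime_comp3) (unfold bid_ok_def, intro ptime_intros)

lemma ptime_pairs [ptime_intros]: "ptime f \<Longrightarrow> ptime (\<lambda>x. pairs (f x))"
  by (rule ptime_comp) (unfold pairs_def, intro ptime_intros)

lemma ptime_bid [ptime_intros]: "ptime f \<Longrightarrow> ptime g \<Longrightarrow> ptime (\<lambda>x. bid (f x) (g x))"
  by (rule ptime_comp2) (unfold bid_def, intro ptime_intros)

lemma sz_bid: "sz (bid N L) \<le> sz L + (sz (pairs (length N)) + 1)"
proof (cases "filter (bid_ok N L) (pairs (length N))")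
  case (Cons e es)
  then have "e \<in> set (pairs (length N))" by (metis filter_is_subset list.set_intros(1) subsetD)
  then show ?thesis using sz_elem[of e] Cons by (simp add: bid_def)
qed (simp add: bid_def)

lemma ptime_auction [ptime_intros]: "ptime f \<Longrightarrow> ptime (\<lambda>x. auction (f x))"
  by (rule ptime_comp, unfold auction_def, rule ptime_foldl_add[OF _ _ _ _ sz_bid])
    (intro ptime_intros pbound_intros pbound_ptime)+

lemma ptime_gap [ptime_intros]: "ptime f \<Longrightarrow> ptime g \<Longrightarrow> ptime (\<lambda>x. gap (f x) (g x))"
  by (rule ptime_comp2) (unfold gap_def, intro ptime_intros)

lemma ptime_cover_of [ptime_intros]:
  "ptime f \<Longrightarrow> ptime g \<Longrightarrow> ptime h \<Longrightarrow> ptime (\<lambda>x. cover_of (f x) (g x) (h x))"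
  by (rule ptime_comp3) (unfold cover_of_def, intro ptime_intros)

lemma ptime_cover [ptime_intros]: "ptime f \<Longrightarrow> ptime (\<lambda>x. cover (f x))"
  unfolding cover_def by (intro ptime_intros)

lemma ptime_half [ptime_intros]: "ptime f \<Longrightarrow> ptime g \<Longrightarrow> ptime (\<lambda>x. half (f x) (g x))"
  by (rule ptime_comp2) (unfold half_def, intro ptime_intros)

lemma ptime_kernel_matrix [ptime_intros]:
  "ptime f \<Longrightarrow> ptime g \<Longrightarrow> ptime (\<lambda>x. kernel_matrix (f x) (g x))"
  by (rule ptime_comp2) (unfold kernel_matrix_def link_def, intro ptime_intros)

lemma ptime_ripple [ptime_intros]:
  assumes "ptime f"
  shows "ptime (\<lambda>x. ripple d (f x))"
  unfolding ripple_def
proof (rule ptime_foldl_add)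
  show "pbound (\<lambda>x :: 'a. 7)" by (rule pbound_const)
  show "sz (fst a \<and> y = d, (fst a \<noteq> y) # snd a) \<le> sz a + 7" for a :: "bool \<times> bool list" and y
    using sz_bool[of "fst a \<and> y = d"] sz_bool[of "fst a \<noteq> y"] by (cases a) simp
qed (intro ptime_intros assms)+

lemma ptime_incr [ptime_intros]: "ptime f \<Longrightarrow> ptime (\<lambda>x. incr (f x))"
  by (rule ptime_comp) (unfold incr_def, intro ptime_intros)

lemma length_ripple: "length (snd (ripple d bs)) = length bs"
proof -
  have "length (snd (foldl (\<lambda>a b. (fst a \<and> b = d, (fst a \<noteq> b) # snd a)) a bs)) =
    length (snd a) + length bs" for a :: "bool \<times> bool list"
    by (induction bs arbitrary: a) auto
  then show ?thesis by (simp add: ripple_def)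
qed

text \<open>A round rewrites the whole number, and a digit may grow from size 1 to size 3, but the
  number of digits is fixed. Each digit thus accounts for at most 4, its size and the node of the
  list.\<close>

lemma ptime_countdown [ptime_intros]:
  "ptime f \<Longrightarrow> ptime g \<Longrightarrow> ptime (\<lambda>x. countdown (f x :: 'a::enc list) (g x))"
proof (rule ptime_comp2[where h = countdown])
  have len: "length (snd (countdown xs bs)) = length bs" for xs :: "'a list" and bs
    by (induction xs rule: rev_induct) (auto simp: countdown_def length_ripple)
  have "sz (countdown xs bs) \<le> 3 + (sz bs * 4 + 1) + 1" for xs :: "'a list" and bs
  proof -
    have "sz (countdown xs bs) = sz (fst (countdown xs bs)) + sz (snd (countdown xs bs)) + 1"
      by (metis prod.collapse sz_simps(4))
    moreover have "sz (snd (countdown xs bs)) \<le> length bs * 4 + 1"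
      using sz_list_le[of "snd (countdown xs bs)" 3, OF sz_bool] by (simp add: len)
    ultimately show ?thesis
      using sz_bool[of "fst (countdown xs bs)"] length_le_sz[of bs] by linarith
  qed
  then show "ptime (\<lambda>p. countdown (fst p :: 'a::enc list) (snd p))"
    unfolding countdown_def
    by (intro ptime_foldl[where B = "\<lambda>p. 3 + (sz (snd p) * 4 + 1) + 1"] ptime_intros
      pbound_intros pbound_ptime)
qed

lemma ptime_kernel: "ptime kernel"
  unfolding kernel_def by (intro ptime_intros)

section \<open>Identification to a forest and vertex covers of the nonbridges\<close>

definition step_avoiding :: "'a graph \<Rightarrow> 'a set \<Rightarrow> 'a \<Rightarrow> 'a \<Rightarrow> bool" where
  "step_avoiding G e u v \<longleftrightarrow> {u, v} \<in> edges G \<and> {u, v} \<noteq> e"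

text \<open>An edge lies on a cycle iff its ends remain connected without it. Reachability replaces
  cycles, which are lists of distinct vertices, by walks, which can be mapped along an
  identification and lifted back.\<close>

definition nonbridge :: "'a graph \<Rightarrow> 'a \<Rightarrow> 'a \<Rightarrow> bool" where
  "nonbridge G a b \<longleftrightarrow> {a, b} \<in> edges G \<and> (step_avoiding G {a, b})\<^sup>*\<^sup>* a b"

lemma step_avoiding_rtranclp_sym:
  "(step_avoiding G e)\<^sup>*\<^sup>* u v \<Longrightarrow> (step_avoiding G e)\<^sup>*\<^sup>* v u"
  by (rule sympD[OF symp_rtranclp]) (auto simp: symp_def step_avoiding_def insert_commute)

lemma nonbridge_sym: "nonbridge G a b \<Longrightarrow> nonbridge G b a"
  using step_avoiding_rtranclp_sym[of G "{a, b}"] by (simp add: nonbridge_def insert_commute)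

lemma nonbridge_rtranclp_sym: "(nonbridge G)\<^sup>*\<^sup>* u v \<Longrightarrow> (nonbridge G)\<^sup>*\<^sup>* v u"
  by (rule sympD[OF symp_rtranclp]) (auto simp: symp_def nonbridge_sym)

text \<open>A walk around a nonbridge shortens to a path with distinct vertices, which the edge
  closes to a cycle. Conversely, the rest of a cycle is a walk around its first edge.\<close>

lemma forest_iff_no_nonbridge:
  assumes G: "\<forall>e\<in>edges G. e \<subseteq> verts G \<and> card e = 2"
  shows "forest G \<longleftrightarrow> (\<nexists>a b. nonbridge G a b)"
proof
  assume f: "forest G"
  show "\<nexists>a b. nonbridge G a b"
  proof clarify
    fix a b assume nb: "nonbridge G a b"
    then have ab: "a \<noteq> b" "a \<in> verts G" using G by (force simp: nonbridge_def)+
    obtain ys where "rtrancl_path (step_avoiding G {a, b}) a ys b"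
      using nb by (auto simp: nonbridge_def rtranclp_eq_rtrancl_path)
    then obtain xs where xs: "rtrancl_path (step_avoiding G {a, b}) a xs b" "distinct (a # xs)"
      by (rule rtrancl_path_distinct)
    have ne: "xs \<noteq> []" using xs(1) ab by (auto elim: rtrancl_path.cases)
    have last: "last xs = b" using rtrancl_path_last[OF xs(1) ne] .
    have step: "step_avoiding G {a, b} ((a # xs) ! i) (xs ! i)" if "i < length xs" for i
      using rtrancl_path_nth[OF xs(1) that] .
    \<comment> \<open>A path with a single step would be the avoided edge itself. This gives the
      third vertex of the cycle.\<close>
    have len: "length xs \<noteq> 1"
    proof
      assume "length xs = 1"
      then have "xs = [b]" using last by (cases xs) auto
      then show False using step[of 0] by (simp add: step_avoiding_def)
    qed
    have "is_cycle G (a # xs)"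
      unfolding is_cycle_def
    proof (intro conjI allI impI)
      show "3 \<le> length (a # xs)" using len ne by (cases xs; cases "tl xs") auto
      have "xs ! i \<in> verts G" if "i < length xs" for i
        using step[OF that] G by (auto simp: step_avoiding_def)
      then show "set (a # xs) \<subseteq> verts G" using ab by (auto simp: in_set_conv_nth)
      fix i assume i: "i < length (a # xs)"
      show "{(a # xs) ! i, (a # xs) ! (Suc i mod length (a # xs))} \<in> edges G"
      proof (cases "i < length xs")
        case True
        then show ?thesis using step[OF True] by (simp add: step_avoiding_def)
      next
        case False
        then have "i = length xs" using i by simp
        then have "(a # xs) ! i = b" using last ne by (simp add: last_conv_nth nth_Cons')
        then show ?thesis using nb \<open>i = length xs\<close> by (simp add: nonbridge_def insert_commute)
      qed
    qed (rule xs(2))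
    then show False using f by (auto simp: forest_def)
  qed
next
  assume nb: "\<nexists>a b. nonbridge G a b"
  show "forest G"
    unfolding forest_def
  proof clarify
    fix vs assume c: "is_cycle G vs"
    define m where "m = length vs"
    have m: "m \<ge> 3" "distinct vs"
      and e: "\<And>i. i < m \<Longrightarrow> {vs ! i, vs ! (Suc i mod m)} \<in> edges G"
      using c by (auto simp: is_cycle_def m_def)
    have neq: "vs ! i \<noteq> vs ! j" if "i < m" "j < m" "i \<noteq> j" for i j
      using that m(2) by (simp add: nth_eq_iff_index_eq m_def)
    let ?s = "step_avoiding G {vs ! 0, vs ! 1}"
    \<comment> \<open>The long way round, starting at \<open>vs ! 1\<close>: every later vertex
      differs from both ends of the avoided edge.\<close>
    have "?s\<^sup>*\<^sup>* (vs ! 1) (vs ! Suc i)" if "Suc i < m" for i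
      using that
    proof (induction i)
      case (Suc i)
      have "vs ! Suc (Suc i) \<notin> {vs ! 0, vs ! 1}" using neq Suc.prems m by simp
      then have "{vs ! Suc i, vs ! Suc (Suc i)} \<noteq> {vs ! 0, vs ! 1}" by blast
      then have "?s (vs ! Suc i) (vs ! Suc (Suc i))"
        using e[of "Suc i"] Suc.prems by (simp add: step_avoiding_def)
      with Suc show ?case by (auto intro: rtranclp.rtrancl_into_rtrancl)
    qed simp
    from this[of "m - 2"] have "?s\<^sup>*\<^sup>* (vs ! 1) (vs ! (m - 1))" using m
      by (simp add: Suc_diff_Suc numeral_2_eq_2)
    moreover have "?s (vs ! (m - 1)) (vs ! 0)"
    proof -
      have "vs ! (m - 1) \<notin> {vs ! 0, vs ! 1}" using neq[of "m - 1" 0] neq[of "m - 1" 1] m by auto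
      then have "{vs ! (m - 1), vs ! 0} \<noteq> {vs ! 0, vs ! 1}" by blast
      then show ?thesis using e[of "m - 1"] m by (simp add: step_avoiding_def)
    qed
    ultimately have "?s\<^sup>*\<^sup>* (vs ! 1) (vs ! 0)" by (rule rtranclp.rtrancl_into_rtrancl)
    then have "nonbridge G (vs ! 0) (vs ! 1)"
      using e[of 0] m step_avoiding_rtranclp_sym[of G] by (simp add: nonbridge_def)
    then show False using nb by blast
  qed
qed

lemma identify_wf:
  assumes "simple_graph G" "S \<subseteq> verts G" "partition_on S P"
  shows "\<forall>e\<in>edges (identify G P). e \<subseteq> verts (identify G P) \<and> card e = 2"
proof
  fix e assume "e \<in> edges (identify G P)"
  then obtain u v where e: "e = {ident_map P u, ident_map P v}" "{u, v} \<in> edges G"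
    "ident_map P u \<noteq> ident_map P v" by (auto simp: identify_def)
  have "ident_map P w \<in> verts (identify G P)" if "w \<in> verts G" for w
  proof (cases "w \<in> \<Union>P")
    case True
    then obtain X where X: "X \<in> P" "w \<in> X" by blast
    then have "(THE X. X \<in> P \<and> w \<in> X) = X"
      using assms(3) by (intro the_equality) (auto simp: partition_on_def disjoint_def)
    then show ?thesis using True X by (simp add: ident_map_def identify_def)
  qed (use that in \<open>simp add: ident_map_def identify_def\<close>)
  moreover have "u \<in> verts G" "v \<in> verts G" using assms(1) e(2) by (auto simp: simple_graph_def)
  ultimately show "e \<subseteq> verts (identify G P) \<and> card e = 2" using e by auto
qed

lemma identified_set_covers_nonbridges:
  assumes "simple_graph G" "S \<subseteq> verts G" "partition_on S P" "forest (identify G P)"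
    and nb: "nonbridge G a b"
  shows "a \<in> S \<or> b \<in> S"
proof (rule ccontr)
  assume "\<not> (a \<in> S \<or> b \<in> S)"
  moreover have S: "\<Union>P = S" using assms(3) by (simp add: partition_on_def)
  ultimately have ab: "ident_map P a = Inl a" "ident_map P b = Inl b" by (auto simp: ident_map_def)
  \<comment> \<open>A surviving vertex has only itself as preimage. Hence no edge other than
    \<open>{a, b}\<close> is mapped onto \<open>{Inl a, Inl b}\<close>, and the image of a walk
    around \<open>{a, b}\<close> still avoids that edge.\<close>
  have inl: "ident_map P x = Inl y \<longleftrightarrow> x = y \<and> y \<notin> S" for x y
    using S by (auto simp: ident_map_def)
  have "a \<noteq> b" using nb assms(1) by (auto simp: nonbridge_def simple_graph_def)
  let ?s = "step_avoiding (identify G P) {Inl a, Inl b}"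
  have "?s\<^sup>*\<^sup>* (ident_map P a) (ident_map P y)" if "(step_avoiding G {a, b})\<^sup>*\<^sup>* a y" for y
    using that
  proof (induction rule: rtranclp_induct)
    case (step u v)
    show ?case
    proof (cases "ident_map P u = ident_map P v")
      case False
      then have "{ident_map P u, ident_map P v} \<in> edges (identify G P)"
        using step(2) by (auto simp: identify_def step_avoiding_def)
      moreover have "{ident_map P u, ident_map P v} \<noteq> {Inl a, Inl b}"
        using step(2) by (auto simp: doubleton_eq_iff inl step_avoiding_def)
      ultimately show ?thesis using step(3)
        by (auto simp: step_avoiding_def intro: rtranclp.rtrancl_into_rtrancl)
    qed (use step in simp)
  qed simp
  from this[of b] have "?s\<^sup>*\<^sup>* (Inl a) (Inl b)" using nb ab by (simp add: nonbridge_def)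
  moreover have "{ident_map P a, ident_map P b} \<in> edges (identify G P)"
    using nb ab \<open>a \<noteq> b\<close> by (force simp: identify_def nonbridge_def)
  ultimately have "nonbridge (identify G P) (Inl a) (Inl b)" by (simp add: nonbridge_def ab)
  then show False
    using assms(4) forest_iff_no_nonbridge[OF identify_wf[OF assms(1-3)]] by blast
qed

text \<open>Cut the walk at its last visit to \<open>b\<close>; in the induction every step out of
  \<open>b\<close> starts afresh.\<close>

lemma rtranclp_last_departure:
  assumes "r\<^sup>*\<^sup>* b a" "a \<noteq> b"
  shows "\<exists>y. r b y \<and> (\<lambda>u v. r u v \<and> u \<noteq> b \<and> v \<noteq> b)\<^sup>*\<^sup>* y a"
proof -
  have "a = b \<or> (\<exists>y. r b y \<and> (\<lambda>u v. r u v \<and> u \<noteq> b \<and> v \<noteq> b)\<^sup>*\<^sup>* y a)"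
    using assms(1)
  proof (induction rule: rtranclp_induct)
    case (step u v)
    then show ?case
      by (cases "u = b"; cases "v = b") (auto intro: rtranclp.rtrancl_into_rtrancl)
  qed simp
  with assms(2) show ?thesis by simp
qed

text \<open>By \<open>lift\<close>, identification creates no new nonbridges; by
  \<open>star\<close>, the old ones that survive as edges become bridges, since each joins the block
  of its component to a single vertex outside \<open>X\<close>.\<close>

lemma cover_of_nonbridges_identifies:
  fixes G :: "'a graph"
  assumes G: "simple_graph G" and X: "X \<subseteq> verts G" "\<And>a b. nonbridge G a b \<Longrightarrow> a \<in> X \<or> b \<in> X"
  shows "\<exists>P. partition_on X P \<and> forest (identify G P)"
proof -
  define Q where "Q = (nonbridge G)\<^sup>*\<^sup>*"
  have Q: "Q x x" "Q x y \<Longrightarrow> Q y x" "Q x y \<Longrightarrow> Q y z \<Longrightarrow> Q x z" for x y z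
    using nonbridge_rtranclp_sym by (auto simp: Q_def)
  have Q_class: "{z\<in>X. Q x z} = {z\<in>X. Q y z}" if "Q x y" for x y
    using that Q(2,3) by blast
  define P where "P = (\<lambda>x. {y\<in>X. Q x y}) ` X"
  have P_class: "A = {y\<in>X. Q x y}" if "A \<in> P" "x \<in> A" for A x
    using that Q_class by (auto simp: P_def)
  have P: "partition_on X P"
    unfolding partition_on_def
  proof (intro conjI disjointI)
    show "\<Union>P = X" "{} \<notin> P" using Q(1) by (auto simp: P_def)
    show "A \<inter> B = {}" if "A \<in> P" "B \<in> P" "A \<noteq> B" for A B
      using that P_class by blast
  qed
  define \<phi> where "\<phi> = ident_map P"
  have UP: "\<Union>P = X" using P by (simp add: partition_on_def)
  have in_X: "\<phi> x = Inr {y\<in>X. Q x y}" if "x \<in> X" for x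
  proof -
    have "(THE Y. Y \<in> P \<and> x \<in> Y) = {y\<in>X. Q x y}"
    proof (rule the_equality)
      show "{y\<in>X. Q x y} \<in> P \<and> x \<in> {y\<in>X. Q x y}" using that Q(1) by (simp add: P_def)
    qed (use P_class in blast)
    then show ?thesis using that UP by (simp add: \<phi>_def ident_map_def)
  qed
  have notin_X: "\<phi> x = Inl x" if "x \<notin> X" for x
    using that UP by (simp add: \<phi>_def ident_map_def)
  have \<phi>_Q: "Q x y" if "\<phi> x = \<phi> y" for x y
  proof (cases "x \<in> X \<and> y \<in> X")
    case True
    then have "y \<in> {z\<in>X. Q x z}" using that in_X[of x] in_X[of y] Q(1)[of y] by auto
    then show ?thesis by simp
  next
    case False
    then have "x = y" using that in_X[of x] in_X[of y] notin_X[of x] notin_X[of y] by fastforce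
    then show ?thesis using Q(1) by simp
  qed
  have \<phi>_eq: "\<phi> x = \<phi> y" if "Q x y" "x \<in> X" "y \<in> X" for x y
    using that in_X Q_class by auto
  let ?H = "identify G P"
  have edge: "{\<phi> u, \<phi> v} \<in> edges ?H" if "{u, v} \<in> edges G" "\<phi> u \<noteq> \<phi> v" for u v
    using that by (auto simp: identify_def \<phi>_def)
  have edgeE: "\<exists>u v. y = \<phi> u \<and> z = \<phi> v \<and> {u, v} \<in> edges G \<and> \<phi> u \<noteq> \<phi> v"
    if yz: "{y, z} \<in> edges ?H" for y z
  proof -
    obtain u v where "{y, z} = {\<phi> u, \<phi> v}" "{u, v} \<in> edges G" "\<phi> u \<noteq> \<phi> v"
      using yz by (auto simp: identify_def \<phi>_def)
    then show ?thesis unfolding doubleton_eq_iff by (metis insert_commute)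
  qed
  \<comment> \<open>Vertices with the same image are joined by nonbridges, hence by walks that avoid
    a bridge \<open>{a, b}\<close>. Inserting these walks wherever a block is passed turns a walk of
    \<open>?H\<close> into a walk of \<open>G\<close>.\<close>
  have lift: "nonbridge G a b" if ab: "{a, b} \<in> edges G" and nb: "nonbridge ?H (\<phi> a) (\<phi> b)" for a b
  proof (rule ccontr)
    assume br: "\<not> nonbridge G a b"
    have Q_step: "(step_avoiding G {a, b})\<^sup>*\<^sup>* x y" if "Q x y" for x y
      using that unfolding Q_def
    proof (induction rule: rtranclp_induct)
      case (step u v)
      have "{u, v} \<noteq> {a, b}" using step(2) br nonbridge_sym[of G b a]
        by (auto simp: doubleton_eq_iff)
      then have "step_avoiding G {a, b} u v" using step(2)
        by (simp add: step_avoiding_def nonbridge_def)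
      with step(3) show ?case by (rule rtranclp.rtrancl_into_rtrancl)
    qed simp
    have "\<forall>y. \<phi> y = y' \<longrightarrow> (step_avoiding G {a, b})\<^sup>*\<^sup>* a y"
      if "(step_avoiding ?H {\<phi> a, \<phi> b})\<^sup>*\<^sup>* (\<phi> a) y'" for y'
      using that
    proof (induction rule: rtranclp_induct)
      case base
      then show ?case using Q_step \<phi>_Q by metis
    next
      case (step y' z')
      obtain u v where uv: "y' = \<phi> u" "z' = \<phi> v" "{u, v} \<in> edges G"
        using edgeE step(2) unfolding step_avoiding_def by metis
      have "{u, v} \<noteq> {a, b}" using step(2) uv by (force simp: step_avoiding_def doubleton_eq_iff)
      then have "step_avoiding G {a, b} u v" using uv(3) by (simp add: step_avoiding_def)
      moreover have "(step_avoiding G {a, b})\<^sup>*\<^sup>* a u" using step(3) uv(1) by simp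
      ultimately have "(step_avoiding G {a, b})\<^sup>*\<^sup>* a v"
        by (rule rtranclp.rtrancl_into_rtrancl[rotated])
      then show ?case using uv(2) \<phi>_Q[of v] Q_step[of v] by (metis rtranclp_trans)
    qed
    then have "nonbridge G a b" using nb ab by (auto simp: nonbridge_def)
    with br show False by contradiction
  qed
  \<comment> \<open>The end \<open>b\<close> is a single vertex, and a walk around the edge must
    leave it by another edge to some \<open>c\<close>. If this edge were a nonbridge of
    \<open>G\<close>, then \<open>c\<close> would lie in \<open>X\<close> and in the block of
    \<open>a\<close>. So it is a bridge of \<open>G\<close>; but the rest of the walk, which does
    not return to \<open>b\<close>, together with the edge from \<open>a\<close> to \<open>b\<close>
    makes it a nonbridge of \<open>?H\<close>, against \<open>lift\<close>.\<close>
  have star: False if nb: "nonbridge G a b" "nonbridge ?H (\<phi> a) (\<phi> b)" "\<phi> a \<noteq> \<phi> b"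
    and a: "a \<in> X" for a b
  proof -
    have "Q a b" using nb(1) by (simp add: Q_def)
    then have b: "b \<notin> X" using \<phi>_eq a nb(3) by blast
    let ?s = "step_avoiding ?H {\<phi> a, \<phi> b}"
    have "?s\<^sup>*\<^sup>* (\<phi> b) (\<phi> a)"
      using nb(2) step_avoiding_rtranclp_sym by (auto simp: nonbridge_def)
    from rtranclp_last_departure[OF this nb(3)] obtain y where y: "?s (\<phi> b) y"
      and path: "(\<lambda>u v. ?s u v \<and> u \<noteq> \<phi> b \<and> v \<noteq> \<phi> b)\<^sup>*\<^sup>* y (\<phi> a)"
      by blast
    obtain u c where uc: "\<phi> b = \<phi> u" "y = \<phi> c" "{u, c} \<in> edges G" "\<phi> u \<noteq> \<phi> c"
      using y edgeE unfolding step_avoiding_def by metis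
    have "u = b" using uc(1) notin_X[OF b] in_X[of u] notin_X[of u] by (cases "u \<in> X") auto
    then have c: "{b, c} \<in> edges G" "\<phi> b \<noteq> \<phi> c" using uc by auto
    have ca: "\<phi> c \<noteq> \<phi> a" using y uc by (auto simp: step_avoiding_def)
    have br: "\<not> nonbridge G b c"
    proof
      assume bc: "nonbridge G b c"
      then have "Q b c" "c \<in> X" using X(2) b by (auto simp: Q_def)
      then show False using ca \<phi>_eq[of a c] \<open>Q a b\<close> Q(3) a by metis
    qed
    have "(step_avoiding ?H {\<phi> b, \<phi> c})\<^sup>*\<^sup>* (\<phi> c) (\<phi> a)"
      using path unfolding uc(2)
      by (rule rtranclp_mono[THEN predicate2D, rotated])
        (auto simp: step_avoiding_def doubleton_eq_iff)
    moreover have "step_avoiding ?H {\<phi> b, \<phi> c} (\<phi> a) (\<phi> b)"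
      using nb ca by (auto simp: step_avoiding_def nonbridge_def doubleton_eq_iff)
    ultimately have "(step_avoiding ?H {\<phi> b, \<phi> c})\<^sup>*\<^sup>* (\<phi> b) (\<phi> c)"
      by (rule step_avoiding_rtranclp_sym[OF rtranclp.rtrancl_into_rtrancl])
    then have "nonbridge ?H (\<phi> b) (\<phi> c)" using edge[OF c] by (simp add: nonbridge_def)
    with lift[OF c(1)] br show False by blast
  qed
  have "forest ?H"
    unfolding forest_iff_no_nonbridge[OF identify_wf[OF G X(1) P]]
  proof clarify
    fix a' b' assume nb: "nonbridge ?H a' b'"
    then obtain a b where ab: "a' = \<phi> a" "b' = \<phi> b" "{a, b} \<in> edges G" "\<phi> a \<noteq> \<phi> b"
      using edgeE unfolding nonbridge_def by metis
    then have 1: "nonbridge G a b" using lift nb by simp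
    show False
      using X(2)[OF 1]
    proof
      assume "a \<in> X"
      then show False using star[OF 1] nb ab by simp
    next
      assume "b \<in> X"
      then show False using star[OF nonbridge_sym[OF 1]] nonbridge_sym[OF nb] ab by simp
    qed
  qed
  with P show ?thesis by blast
qed

theorem identification_to_forest_iff_vertex_cover:
  assumes "simple_graph G"
  shows "admits_identification k forest G \<longleftrightarrow>
    (\<exists>X \<subseteq> verts G. card X \<le> k \<and> (\<forall>a b. nonbridge G a b \<longrightarrow> a \<in> X \<or> b \<in> X))"
proof
  assume "admits_identification k forest G"
  then show "\<exists>X \<subseteq> verts G. card X \<le> k \<and> (\<forall>a b. nonbridge G a b \<longrightarrow> a \<in> X \<or> b \<in> X)"
    unfolding admits_identification_def using identified_set_covers_nonbridges[OF assms] by metis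
next
  assume "\<exists>X \<subseteq> verts G. card X \<le> k \<and> (\<forall>a b. nonbridge G a b \<longrightarrow> a \<in> X \<or> b \<in> X)"
  then show "admits_identification k forest G"
    unfolding admits_identification_def using cover_of_nonbridges_identifies[OF assms] by metis
qed

section \<open>The auction\<close>

lemma price_simps [simp]:
  "price [] v = 0" "price (e # L) v = (if snd e = v then Suc (price L v) else price L v)"
  by (auto simp: price_def)

lemma owns_simps [simp]:
  "owns [] u v \<longleftrightarrow> False" "owns (e # L) u v \<longleftrightarrow> (if snd e = v then fst e = u else owns L u v)"
  by (auto simp: owns_def)

lemma owns_in_set: "owns L u v \<Longrightarrow> (u, v) \<in> set L"
  by (induction L) (auto split: if_splits)

lemma owner_unique: "owns L u v \<Longrightarrow> owns L u' v \<Longrightarrow> u = u'"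
  by (induction L) (auto split: if_splits)

lemma ex_owner: "0 < price L v \<Longrightarrow> \<exists>u. owns L u v"
  by (induction L) (auto split: if_splits)

lemma length_eq_sum_price: "snd ` set L \<subseteq> {..<n} \<Longrightarrow> length L = (\<Sum>v<n. price L v)"
proof (induction L)
  case (Cons e L)
  have "(\<Sum>v<n. price (e # L) v) = (\<Sum>v<n. price L v + of_bool (v = snd e))"
    by (rule sum.cong) auto
  also have "\<dots> = (\<Sum>v<n. price L v) + 1"
    using Cons.prems by (simp add: sum.distrib of_bool_def)
  finally show ?case using Cons by simp
qed simp

lemma set_pairs: "set (pairs n) = {..<n} \<times> {..<n}"
  by (auto simp: pairs_def)

lemma length_pairs: "length (pairs n) = n * n"
  by (simp add: pairs_def length_concat o_def sum_list_triv)

locale double_cover =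
  fixes N :: "bool list list"
  assumes entry_irrefl: "\<not> entry N v v"
    and entry_less: "entry N u v \<Longrightarrow> u < length N \<and> v < length N"
    and entry_sym: "entry N u v \<Longrightarrow> entry N v u"
begin

abbreviation "n \<equiv> length N"

text \<open>
  The last invariant is approximate complementary slackness: an owner paid at most one more than
  the price of its cheapest alternative.
\<close>

definition log_ok :: "(nat \<times> nat) list \<Rightarrow> bool" where
  "log_ok L \<longleftrightarrow> (\<forall>(u, v)\<in>set L. entry N u v) \<and> (\<forall>v. price L v \<le> n + 1) \<and>
     (\<forall>u v w. owns L u v \<longrightarrow> owns L u w \<longrightarrow> v = w) \<and>
     (\<forall>u v w. owns L u v \<longrightarrow> entry N u w \<longrightarrow> price L v \<le> price L w + 1)"

lemma owns_entry: "log_ok L \<Longrightarrow> owns L u v \<Longrightarrow> entry N u v"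
  using owns_in_set[of L u v] by (auto simp: log_ok_def)

text \<open>Slackness survives because prices only rise: for the bidder, \<open>b\<close> was a
  cheapest neighbour before the increase; for any other remaining owner, its own price is unchanged
  and the alternatives have not become cheaper. The bidder owned nothing, so it now owns only
  \<open>b\<close>.\<close>

lemma log_ok_bid:
  assumes L: "log_ok L"
  shows "log_ok (bid N L)"
proof (cases "filter (bid_ok N L) (pairs n)")
  case Nil
  then show ?thesis using L by (simp add: bid_def)
next
  case (Cons e es)
  obtain a b where e: "e = (a, b)" by (cases e)
  have "bid_ok N L e" using Cons by (metis filter_eq_ConsD)
  then have ab: "entry N a b" "price L b \<le> n" "\<And>w. w < n \<Longrightarrow> \<not> owns L a w"
    "\<And>w. entry N a w \<Longrightarrow> price L b \<le> price L w"
    using entry_less by (auto simp: bid_ok_def e)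
  have free: "\<not> owns L a w" for w
    using ab(3) owns_entry[OF L] entry_less by blast
  have "log_ok ((a, b) # L)"
    unfolding log_ok_def
  proof (intro conjI allI impI)
    fix u v w assume uv: "owns ((a, b) # L) u v"
    show "owns ((a, b) # L) u w \<Longrightarrow> v = w"
      using uv L free by (auto simp: log_ok_def split: if_splits)
    show "price ((a, b) # L) v \<le> price ((a, b) # L) w + 1" if w: "entry N u w"
    proof (cases "b = v")
      case True
      then show ?thesis using uv ab(4)[of w] w by auto
    next
      case False
      then have "price L v \<le> price L w + 1" using uv w L by (auto simp: log_ok_def)
      then show ?thesis using False by simp
    qed
  next
    show "price ((a, b) # L) v \<le> n + 1" for v
      using L ab(2) by (cases "b = v") (simp_all add: log_ok_def)
    show "\<forall>(u, v)\<in>set ((a, b) # L). entry N u v" using L ab(1) by (simp add: log_ok_def)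
  qed
  then show ?thesis using Cons e by (simp add: bid_def)
qed

lemma log_ok_auction: "log_ok (auction N)"
proof -
  have "log_ok L \<Longrightarrow> log_ok (foldl (\<lambda>L _. bid N L) L ys)" for L and ys :: "(nat \<times> nat) list"
    by (induction ys arbitrary: L) (auto intro: log_ok_bid)
  moreover have "log_ok []" by (simp add: log_ok_def)
  ultimately show ?thesis unfolding auction_def .
qed

text \<open>A log that can still change has received a bid in every round, so it has length (n +
  1)^2. But each bid raises one price by 1, and n prices of at most n + 1 sum to at most n(n +
  1).\<close>

lemma auction_stuck: "bid N (auction N) = auction N"
proof (rule ccontr)
  assume ne: "bid N (auction N) \<noteq> auction N"
  have "bid N (foldl (\<lambda>L _. bid N L) [] ys) = foldl (\<lambda>L _. bid N L) [] ys \<or>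
      length (foldl (\<lambda>L _. bid N L) [] ys) = length ys" for ys :: "(nat \<times> nat) list"
  proof (induction ys rule: rev_induct)
    case (snoc y ys)
    let ?L = "foldl (\<lambda>L _. bid N L) [] ys"
    have "bid N ?L = ?L \<or> length (bid N ?L) = Suc (length ?L)"
      by (auto simp: bid_def split: list.split)
    then show ?case using snoc by auto
  qed simp
  from this[of "pairs (Suc n)"] have "length (auction N) = (n + 1) * (n + 1)"
    using ne unfolding auction_def length_pairs by simp
  moreover have "length (auction N) = (\<Sum>v<n. price (auction N) v)"
    by (rule length_eq_sum_price) (use log_ok_auction entry_less in \<open>fastforce simp: log_ok_def\<close>)
  moreover have "\<dots> \<le> (\<Sum>v<n. n + 1)"
    by (rule sum_mono) (use log_ok_auction in \<open>simp add: log_ok_def\<close>)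
  ultimately show False by simp
qed

text \<open>Otherwise a bid for the cheapest neighbour of \<open>u\<close> would be admissible, and
  the auction would not be stuck.\<close>

lemma priced_out:
  assumes free: "\<And>w. \<not> owns (auction N) u w" and uv: "entry N u v"
  shows "price (auction N) v > n"
proof (rule ccontr)
  assume "\<not> n < price (auction N) v"
  obtain w where w: "entry N u w" "\<And>w'. entry N u w' \<Longrightarrow> price (auction N) w \<le> price (auction N) w'"
    using ex_has_least_nat[of "entry N u" v "price (auction N)"] uv by blast
  have "bid_ok N (auction N) (u, w)"
    using w free w(2)[OF uv] \<open>\<not> n < _\<close> by (auto simp: bid_ok_def)
  moreover have "(u, w) \<in> set (pairs n)" using entry_less[OF w(1)] by (simp add: set_pairs)
  ultimately have "filter (bid_ok N (auction N)) (pairs n) \<noteq> []" by (auto simp: filter_empty_conv)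
  then have "bid N (auction N) \<noteq> auction N" by (auto simp: bid_def split: list.split)
  then show False using auction_stuck by simp
qed

definition "lev \<equiv> gap n (auction N)"

lemma lev_bounds: "lev \<le> n + 1" "v < n \<Longrightarrow> price (auction N) v \<noteq> lev"
proof -
  let ?P = "\<lambda>l. \<forall>v\<in>set [0..<n]. price (auction N) v \<noteq> l"
  have "\<not> Suc ` {..<Suc n} \<subseteq> price (auction N) ` {..<n}"
  proof
    assume "Suc ` {..<Suc n} \<subseteq> price (auction N) ` {..<n}"
    then have "card (Suc ` {..<Suc n}) \<le> card {..<n}" by (meson finite_lessThan surj_card_le)
    then show False by (simp add: card_image)
  qed
  then obtain m where m: "m < Suc n" "Suc m \<notin> price (auction N) ` {..<n}" by blast
  have "Suc m \<in> set (map Suc [0..<Suc n])" "?P (Suc m)"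
    using m by (auto simp: image_iff) (metis lessThan_iff)
  then have "filter ?P (map Suc [0..<Suc n]) \<noteq> []" unfolding filter_empty_conv by blast
  then obtain l ls where l: "filter ?P (map Suc [0..<Suc n]) = l # ls" by (meson neq_Nil_conv)
  then have "lev = l" by (simp only: lev_def gap_def list.case)
  moreover have "l \<in> set (filter ?P (map Suc [0..<Suc n]))" unfolding l by simp
  then have "l \<in> set (map Suc [0..<Suc n])" "?P l" unfolding set_filter by blast+
  ultimately show "lev \<le> n + 1" "v < n \<Longrightarrow> price (auction N) v \<noteq> lev" by auto
qed

lemma cover_iff:
  "(u, False) \<in> set (cover N) \<longleftrightarrow> (\<exists>v. owns (auction N) u v \<and> price (auction N) v < lev)"
  "(v, True) \<in> set (cover N) \<longleftrightarrow> v < n \<and> lev < price (auction N) v"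
proof -
  have "(u, False) \<in> set (cover N) \<longleftrightarrow>
      u < n \<and> (\<exists>v<n. owns (auction N) u v \<and> price (auction N) v < lev)"
    by (auto simp: cover_def cover_of_def lev_def image_iff)
  then show "(u, False) \<in> set (cover N) \<longleftrightarrow> (\<exists>v. owns (auction N) u v \<and> price (auction N) v < lev)"
    using owns_entry[OF log_ok_auction] entry_less by blast
  show "(v, True) \<in> set (cover N) \<longleftrightarrow> v < n \<and> lev < price (auction N) v"
    by (auto simp: cover_def cover_of_def lev_def image_iff)
qed

lemma distinct_cover: "distinct (cover N)"
  by (auto simp: cover_def cover_of_def distinct_map inj_on_def)

lemma cover_less: "c \<in> set (cover N) \<Longrightarrow> fst c < n"
  by (auto simp: cover_def cover_of_def)

text \<open>If \<open>v\<close> is not above the level, it is strictly below it, as the level is not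
  a price. Then \<open>v\<close> costs at most n, so \<open>u\<close> is not priced out and owns
  some \<open>w\<close>.\<close>

lemma cover_covers:
  assumes "entry N u v"
  shows "(u, False) \<in> set (cover N) \<or> (v, True) \<in> set (cover N)"
proof (cases "lev < price (auction N) v")
  case False
  then have v: "price (auction N) v < lev" using lev_bounds(2)[of v] entry_less[OF assms] by auto
  then have "\<not> n < price (auction N) v" using lev_bounds(1) by simp
  then obtain w where w: "owns (auction N) u w" using priced_out assms by blast
  then have "price (auction N) w \<le> price (auction N) v + 1"
    using log_ok_auction assms by (simp add: log_ok_def)
  moreover have "w < n" using owns_entry[OF log_ok_auction w] entry_less by blast
  \<comment> \<open>Slackness only gives a price of at most \<open>lev\<close>; equality is excluded
    because \<open>lev\<close> is not a price.\<close>
  ultimately have "price (auction N) w < lev" using v lev_bounds(2)[of w] by simp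
  then show ?thesis using w by (auto simp: cover_iff)
qed (use assms entry_less in \<open>auto simp: cover_iff\<close>)

text \<open>
  Weak duality, through the matching found by the auction; \<open>y\<close> is twice a fractional vertex cover.
\<close>

lemma length_cover_le:
  fixes y :: "nat \<Rightarrow> nat"
  assumes y: "\<And>u v. entry N u v \<Longrightarrow> 2 \<le> y u + y v"
  shows "length (cover N) \<le> (\<Sum>v<n. y v)"
proof -
  let ?L = "auction N"
  define M where "M = {(u, v). owns ?L u v}"
  define lo where "lo = {e\<in>M. price ?L (snd e) < lev}"
  define hi where "hi = {e\<in>M. lev < price ?L (snd e)}"
  have E: "entry N (fst e) (snd e)" if "e \<in> M" for e
    using that owns_entry[OF log_ok_auction] by (auto simp: M_def)
  have M: "M \<subseteq> {..<n} \<times> {..<n}" using E entry_less by fastforce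
  then have fin: "finite M" by (rule finite_subset) simp
  have inj: "inj_on fst M" "inj_on snd M"
    using log_ok_auction owner_unique by (auto simp: inj_on_def M_def log_ok_def)
  have "length (cover N) = card (set (cover N))" using distinct_cover by (simp add: distinct_card)
  also have "set (cover N) \<subseteq> (\<lambda>e. (fst e, False)) ` lo \<union> (\<lambda>e. (snd e, True)) ` hi"
  proof
    fix c assume c: "c \<in> set (cover N)"
    obtain v b where vb: "c = (v, b)" by (cases c)
    show "c \<in> (\<lambda>e. (fst e, False)) ` lo \<union> (\<lambda>e. (snd e, True)) ` hi"
    proof (cases b)
      case True
      then have v: "lev < price ?L v" using c cover_iff(2) vb by auto
      then obtain u where "owns ?L u v" using ex_owner[of ?L v] by auto
      then have "(u, v) \<in> hi" using v by (simp add: hi_def M_def)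
      then show ?thesis using vb True by force
    next
      case False
      then obtain w where "owns ?L v w" "price ?L w < lev" using c cover_iff(1) vb by auto
      then have "(v, w) \<in> lo" by (simp add: lo_def M_def)
      then show ?thesis using vb False by force
    qed
  qed
  then have "card (set (cover N)) \<le> card ((\<lambda>e. (fst e, False)) ` lo \<union> (\<lambda>e. (snd e, True)) ` hi)"
    by (rule card_mono[rotated]) (use fin in \<open>simp add: lo_def hi_def\<close>)
  also have "\<dots> \<le> card lo + card hi"
    using fin by (intro le_trans[OF card_Un_le] add_mono card_image_le) (simp_all add: lo_def
      hi_def)
  \<comment> \<open>An owned pair lies either below or above the level, so it contributes only one
    of its two ends to the cover.\<close>
  also have "\<dots> = card (lo \<union> hi)"
    using fin by (intro card_Un_disjoint[symmetric]) (auto simp: lo_def hi_def)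
  also have "\<dots> \<le> card M" by (rule card_mono[OF fin]) (auto simp: lo_def hi_def)
  finally have *: "length (cover N) \<le> card M" .
  \<comment> \<open>Left ends are distinct, and so are right ends; each side of the matching
    therefore collects at most the total of \<open>y\<close>.\<close>
  have "card M * 2 \<le> (\<Sum>e\<in>M. y (fst e) + y (snd e))"
    using sum_bounded_below[of M 2 "\<lambda>e. y (fst e) + y (snd e)"] y E by simp
  also have "\<dots> = sum y (fst ` M) + sum y (snd ` M)"
    using inj by (simp add: sum.distrib sum.reindex)
  also have "\<dots> \<le> sum y {..<n} + sum y {..<n}"
    using M by (intro add_mono sum_mono2) auto
  finally show ?thesis using * by simp
qed

end

section \<open>Equivalence of the kernel\<close>

definition vertex_cover :: "('a \<Rightarrow> 'a \<Rightarrow> bool) \<Rightarrow> 'a set \<Rightarrow> bool" where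
  "vertex_cover E X \<longleftrightarrow> (\<forall>a b. E a b \<longrightarrow> a \<in> X \<or> b \<in> X)"

lemma triangle_nonbridge:
  assumes "{a, b} \<in> edges G" "{a, c} \<in> edges G" "{b, c} \<in> edges G" "a \<noteq> c" "b \<noteq> c"
  shows "nonbridge G a b"
proof -
  have "step_avoiding G {a, b} a c" "step_avoiding G {a, b} c b"
    using assms by (auto simp: step_avoiding_def insert_commute)
  then have "(step_avoiding G {a, b})\<^sup>*\<^sup>* a b" by (meson r_into_rtranclp rtranclp_trans)
  with assms(1) show ?thesis by (simp add: nonbridge_def)
qed

context double_cover
begin

definition both :: "nat \<Rightarrow> bool" where
  "both v \<longleftrightarrow> (v, True) \<in> set (cover N) \<and> (v, False) \<in> set (cover N)"

lemma half_iff: "half (cover N) v \<longleftrightarrow> ((v, True) \<in> set (cover N)) \<noteq> ((v, False) \<in> set (cover N))"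
proof -
  have "(\<exists>c\<in>set (cover N). fst c = v \<and> snd c) \<longleftrightarrow> (v, True) \<in> set (cover N)"
    "(\<exists>c\<in>set (cover N). fst c = v \<and> \<not> snd c) \<longleftrightarrow> (v, False) \<in> set (cover N)"
    by force+
  then show ?thesis by (simp add: half_def)
qed

lemma length_cover: "length (cover N) = (\<Sum>v<n. of_bool (half (cover N) v) + 2 * of_bool (both v))"
proof -
  have "length (cover N) = card (set (cover N))" using distinct_cover by (simp add: distinct_card)
  also have "set (cover N) = (\<lambda>v. (v, True)) ` {v\<in>{..<n}. (v, True) \<in> set (cover N)} \<union>
      (\<lambda>v. (v, False)) ` {v\<in>{..<n}. (v, False) \<in> set (cover N)}" (is "_ = ?A \<union> ?B")
  proof -
    have "(v, b) \<in> ?A \<union> ?B" if "(v, b) \<in> set (cover N)" for v b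
      using that cover_less[OF that] by (cases b) auto
    then show ?thesis by auto
  qed
  also have "card (?A \<union> ?B) = card ?A + card ?B" by (rule card_Un_disjoint) auto
  also have "card ?A = (\<Sum>v<n. of_bool ((v, True) \<in> set (cover N)))"
    by (subst card_image) (auto simp: inj_on_def of_bool_def sum.If_cases Int_def)
  also have "card ?B = (\<Sum>v<n. of_bool ((v, False) \<in> set (cover N)))"
    by (subst card_image) (auto simp: inj_on_def of_bool_def sum.If_cases Int_def)
  finally show ?thesis
    unfolding sum.distrib[symmetric]
    by simp (intro sum.cong refl, auto simp: half_iff both_def)
qed

lemma entry_cases: "entry N u v \<Longrightarrow> both u \<or> both v \<or> half (cover N) u \<and> half (cover N) v"
  using cover_covers[of u v] cover_covers[OF entry_sym, of u v] by (auto simp: half_iff both_def)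

abbreviation "cover_link a b \<equiv> a \<in> set (cover N) \<and> b \<in> set (cover N) \<and> link N (cover N) a b"

lemma cover_link_cases:
  assumes "cover_link a b"
  shows "fst a = fst b \<and> snd a \<noteq> snd b \<and> both (fst a) \<or>
    half (cover N) (fst a) \<and> half (cover N) (fst b) \<and> entry N (fst a) (fst b)"
proof (cases "fst a = fst b")
  case True
  then obtain v s t where "a = (v, s)" "b = (v, t)" by (metis prod.collapse)
  then show ?thesis using assms by (cases s; cases t) (auto simp: both_def link_def)
next
  case False
  then show ?thesis using assms cover_less[of a] cover_less[of b] by (auto simp: link_def)
qed

text \<open>The Nemhauser--Trotter theorem, with the vertices in both parts of the cover kept as a
  matching.\<close>

lemma vertex_cover_kernel:
  "(\<exists>X \<subseteq> {..<n}. card X \<le> k \<and> vertex_cover (entry N) X) \<longleftrightarrow>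
   length (cover N) \<le> 2 * k \<and> (\<exists>Z \<subseteq> set (cover N). card Z \<le> k \<and> vertex_cover cover_link Z)"
proof (intro iffI conjI)
  assume "\<exists>X \<subseteq> {..<n}. card X \<le> k \<and> vertex_cover (entry N) X"
  then obtain X where X: "X \<subseteq> {..<n}" "card X \<le> k" "vertex_cover (entry N) X" by blast
  then have fin: "finite X" using finite_subset by blast
  have card_sum: "card Y = (\<Sum>v<n. of_bool (v \<in> Y))" if "Y \<subseteq> {..<n}" for Y
    using that by (simp add: of_bool_def sum.If_cases Int_absorb1)
  have "length (cover N) \<le> (\<Sum>v<n. 2 * of_bool (v \<in> X))"
    by (rule length_cover_le) (use X(3) in \<open>auto simp: vertex_cover_def of_bool_def\<close>)
  then show "length (cover N) \<le> 2 * k"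
    using X(2) card_sum[OF X(1)] by (simp add: sum_distrib_left[symmetric])
  define X' where "X' = {v\<in>{..<n}. both v \<or> half (cover N) v \<and> v \<in> X}"
  \<comment> \<open>In this weight every vertex with a copy in the cover gets 1, and the elements of
    \<open>X\<close> outside the half vertices get 1 more. Against \<open>length_cover\<close> the
    half vertices cancel: there are at most as many vertices with both copies as elements of
    \<open>X\<close> that are not half. Exchanging these for those gives \<open>X'\<close>.\<close>
  have "length (cover N) \<le>
      (\<Sum>v<n. of_bool (both v) + of_bool (half (cover N) v) + of_bool (\<not> half (cover N) v \<and> v \<in> X))"
  proof (rule length_cover_le)
    fix u v assume uv: "entry N u v"
    have "u \<in> X \<or> v \<in> X" using X(3) uv by (simp add: vertex_cover_def)
    then show "(2::nat) \<le> of_bool (both u) + of_bool (half (cover N) u) +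
      of_bool (\<not> half (cover N) u \<and> u \<in> X)
      + (of_bool (both v) + of_bool (half (cover N) v) + of_bool (\<not> half (cover N) v \<and> v \<in> X))"
      using entry_cases[OF uv] by (auto simp: half_iff both_def)
  qed
  then have "(\<Sum>v<n. of_bool (both v) :: nat) \<le> (\<Sum>v<n. of_bool (\<not> half (cover N) v \<and> v \<in> X))"
    unfolding length_cover sum.distrib by (simp add: sum_distrib_left[symmetric])
  moreover have "card X = (\<Sum>v<n. of_bool (\<not> half (cover N) v \<and>
    v \<in> X) + of_bool (half (cover N) v \<and> v \<in> X))"
    unfolding card_sum[OF X(1)] by (rule sum.cong) auto
  moreover have "card X' = (\<Sum>v<n. of_bool (both v) + of_bool (half (cover N) v \<and> v \<in> X))"
    by (subst card_sum) (auto simp: X'_def half_iff both_def intro!: sum.cong)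
  ultimately have X': "card X' \<le> card X" by (simp add: sum.distrib)
  \<comment> \<open>A half vertex of \<open>X'\<close> is represented by its only copy, a vertex
    with two copies by the left one, which covers the edge between them.\<close>
  define Z where "Z = {c\<in>set (cover N). fst c \<in> X' \<and> (half (cover N) (fst c) \<or> \<not> snd c)}"
  have "inj_on fst Z"
  proof (rule inj_onI)
    fix c d assume cd: "c \<in> Z" "d \<in> Z" "fst c = fst d"
    then obtain v s t where "c = (v, s)" "d = (v, t)" by (metis prod.collapse)
    then show "c = d" using cd by (cases s; cases t) (auto simp: Z_def half_iff)
  qed
  then have "card Z = card (fst ` Z)" by (simp add: card_image)
  also have "\<dots> \<le> card X'" by (rule card_mono) (auto simp: Z_def X'_def)
  finally have "card Z \<le> k" using X' X(2) by simp
  moreover have "vertex_cover cover_link Z"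
    unfolding vertex_cover_def
  proof (intro allI impI)
    fix a b assume l: "cover_link a b"
    then have less: "fst a < n" "fst b < n" using cover_less by auto
    from cover_link_cases[OF l] show "a \<in> Z \<or> b \<in> Z"
    proof
      assume "fst a = fst b \<and> snd a \<noteq> snd b \<and> both (fst a)"
      then show ?thesis using l less by (auto simp: Z_def X'_def)
    next
      assume "half (cover N) (fst a) \<and> half (cover N) (fst b) \<and> entry N (fst a) (fst b)"
      then show ?thesis using l less X(3) by (auto simp: Z_def X'_def vertex_cover_def)
    qed
  qed
  ultimately show "\<exists>Z \<subseteq> set (cover N). card Z \<le> k \<and> vertex_cover cover_link Z"
    by (intro exI[of _ Z]) (auto simp: Z_def)
next
  assume "length (cover N) \<le> 2 * k \<and> (\<exists>Z \<subseteq> set (cover N). card Z \<le> k \<and> vertex_cover cover_link Z)"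
  then obtain Z where Z: "Z \<subseteq> set (cover N)" "card Z \<le> k" "vertex_cover cover_link Z" by blast
  then have fin: "finite Z" using finite_subset by blast
  define X where "X = {v\<in>fst ` Z. both v \<or> half (cover N) v}"
  have both: "v \<in> X" if "both v" for v
  proof -
    have "cover_link (v, True) (v, False)" using that by (simp add: both_def link_def)
    then have "(v, True) \<in> Z \<or> (v, False) \<in> Z" using Z(3) unfolding vertex_cover_def by blast
    then show ?thesis using that by (force simp: X_def)
  qed
  have half: "\<exists>b. (v, b) \<in> set (cover N)" if "half (cover N) v" for v
    using that half_iff by blast
  have "u \<in> X \<or> v \<in> X" if uv: "entry N u v" for u v
  proof (cases "half (cover N) u \<and> half (cover N) v \<and> u \<noteq> v")
    case True
    then obtain a b where ab: "(u, a) \<in> set (cover N)" "(v, b) \<in> set (cover N)" using half by blast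
    then have "cover_link (u, a) (v, b)" using True uv by (simp add: link_def)
    then have "(u, a) \<in> Z \<or> (v, b) \<in> Z" using Z(3) unfolding vertex_cover_def by blast
    then show ?thesis using True by (force simp: X_def)
  next
    case False
    then show ?thesis using entry_cases[OF uv] both entry_irrefl[of u] uv by blast
  qed
  then have "vertex_cover (entry N) X" by (simp add: vertex_cover_def)
  moreover have "card X \<le> k"
    using card_mono[of "fst ` Z" X] card_image_le[OF fin, of fst] fin Z(2) by (auto simp: X_def)
  moreover have "X \<subseteq> {..<n}" using Z(1) cover_less by (fastforce simp: X_def)
  ultimately show "\<exists>X \<subseteq> {..<n}. card X \<le> k \<and> vertex_cover (entry N) X" by blast
qed

section \<open>The kernel graph and its universal vertex\<close>

definition root_cover :: "(nat \<times> bool) list" where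
  "root_cover = (n, False) # cover N"

definition kernel_graph :: "nat graph" where
  "kernel_graph = \<lparr> verts = {..<length root_cover},
     edges = {{i, j} | i j. i < length root_cover \<and> j < length root_cover \<and>
       link N (cover N) (root_cover ! i) (root_cover ! j)} \<rparr>"

lemma link_sym: "link N (cover N) a b \<longleftrightarrow> link N (cover N) b a"
  using entry_sym by (auto simp: link_def)

lemma link_irrefl: "\<not> link N (cover N) a a"
  by (simp add: link_def)

lemma kernel_edge: "{i, j} \<in> edges kernel_graph \<longleftrightarrow>
    i < length root_cover \<and> j < length root_cover \<and>
      link N (cover N) (root_cover ! i) (root_cover ! j)"
  using link_sym[of "root_cover ! i" "root_cover ! j"]
  by (auto simp: kernel_graph_def doubleton_eq_iff)

lemma simple_kernel_graph: "simple_graph kernel_graph"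
  unfolding simple_graph_def
proof (intro conjI ballI)
  fix e assume e: "e \<in> edges kernel_graph"
  then obtain i j where ij: "e = {i, j}" by (auto simp: kernel_graph_def)
  then show "e \<subseteq> verts kernel_graph" using e kernel_edge by (simp add: kernel_graph_def)
  have "i \<noteq> j" using e ij kernel_edge link_irrefl by metis
  then show "card e = 2" using ij by simp
qed (simp add: kernel_graph_def)

lemma root_cover_distinct: "distinct root_cover"
  using cover_less distinct_cover by (fastforce simp: root_cover_def)

text \<open>Putting the root into the cover costs the extra unit and reduces the problem to the
  links. Conversely, each link forms a triangle with the root, so all links and the root edges at
  their ends are nonbridges. Root edges to vertices without links may be bridges, so nothing is
  claimed about them.\<close>

lemma vertex_cover_root:
  "(\<exists>Z \<subseteq> set (cover N). card Z \<le> k \<and> vertex_cover cover_link Z) \<longleftrightarrow>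
   (\<exists>Y \<subseteq> verts kernel_graph. card Y \<le> k + 1 \<and> vertex_cover (nonbridge kernel_graph) Y)"
proof
  assume "\<exists>Z \<subseteq> set (cover N). card Z \<le> k \<and> vertex_cover cover_link Z"
  then obtain Z where Z: "Z \<subseteq> set (cover N)" "card Z \<le> k" "vertex_cover cover_link Z" by blast
  define Y where "Y = {i. i < length root_cover \<and> root_cover ! i \<in> insert (n, False) Z}"
  have fin: "finite Z" using Z(1) finite_subset by blast
  have "inj_on ((!) root_cover) Y"
    using root_cover_distinct by (auto simp: inj_on_def Y_def nth_eq_iff_index_eq)
  then have "card Y \<le> card (insert (n, False) Z)"
    by (rule card_inj_on_le) (use fin in \<open>auto simp: Y_def\<close>)
  then have "card Y \<le> k + 1" using Z(2) by (simp add: card_insert_if fin split: if_splits)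
  moreover have "vertex_cover (nonbridge kernel_graph) Y"
    unfolding vertex_cover_def
  proof (intro allI impI)
    fix i j assume "nonbridge kernel_graph i j"
    then have ij: "i < length root_cover" "j < length root_cover"
      "link N (cover N) (root_cover ! i) (root_cover ! j)"
      by (auto simp: nonbridge_def kernel_edge)
    have "root_cover ! i = (n, False) \<or> root_cover ! i \<in> set (cover N)"
      "root_cover ! j = (n, False) \<or> root_cover ! j \<in> set (cover N)"
      using nth_mem[OF ij(1)] nth_mem[OF ij(2)] by (auto simp: root_cover_def)
    then show "i \<in> Y \<or> j \<in> Y"
      using ij Z(3)[unfolded vertex_cover_def, rule_format, of "root_cover ! i" "root_cover ! j"]
      by (auto simp: Y_def)
  qed
  moreover have "Y \<subseteq> verts kernel_graph" by (auto simp: Y_def kernel_graph_def)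
  ultimately show "\<exists>Y \<subseteq> verts kernel_graph. card Y \<le> k + 1 \<and>
    vertex_cover (nonbridge kernel_graph) Y"
    by blast
next
  assume "\<exists>Y \<subseteq> verts kernel_graph. card Y \<le> k + 1 \<and> vertex_cover (nonbridge kernel_graph) Y"
  then obtain Y where Y: "Y \<subseteq> verts kernel_graph" "card Y \<le> k + 1"
    "vertex_cover (nonbridge kernel_graph) Y" by blast
  have fin: "finite Y" using Y(1) finite_subset by (fastforce simp: kernel_graph_def)
  have nb: "nonbridge kernel_graph (Suc i) (Suc j)" "nonbridge kernel_graph 0 (Suc i)"
    if ij: "i < length (cover N)" "j < length (cover N)"
      "link N (cover N) (cover N ! i) (cover N ! j)" for i j
  proof -
    have "cover N ! i \<in> set (cover N)" "cover N ! j \<in> set (cover N)" using ij by simp_all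
    then have "link N (cover N) (n, False) (cover N ! i)"
      "link N (cover N) (n, False) (cover N ! j)"
      using cover_less[of "cover N ! i"] cover_less[of "cover N ! j"] by (simp_all add: link_def)
    then have "{0, Suc i} \<in> edges kernel_graph" "{0, Suc j} \<in> edges kernel_graph"
      "{Suc i, Suc j} \<in> edges kernel_graph"
      using ij by (simp_all add: kernel_edge root_cover_def)
    moreover have "i \<noteq> j" using ij(3) link_irrefl by metis
    ultimately show "nonbridge kernel_graph (Suc i) (Suc j)" "nonbridge kernel_graph 0 (Suc i)"
      using triangle_nonbridge[of "Suc i" "Suc j" kernel_graph 0]
        triangle_nonbridge[of 0 "Suc i" kernel_graph "Suc j"] by (simp_all add: insert_commute)
  qed
  define I where "I = {i. Suc i \<in> Y}"
  have I: "i \<in> I \<or> j \<in> I"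
    if "i < length (cover N)" "j < length (cover N)"
      "link N (cover N) (cover N ! i) (cover N ! j)" for i j
    using nb(1)[OF that] Y(3) by (auto simp: I_def vertex_cover_def)
  have I_less: "I \<subseteq> {..<length (cover N)}" using Y(1)
    by (auto simp: I_def kernel_graph_def root_cover_def)
  then have finI: "finite I" using finite_subset by blast
  have cI: "card (Suc ` I) = card I" by (simp add: card_image)
  have "\<exists>J \<subseteq> I. card J \<le> k \<and> (\<forall>i j. i < length (cover N) \<longrightarrow> j < length (cover N) \<longrightarrow>
      link N (cover N) (cover N ! i) (cover N ! j) \<longrightarrow> i \<in> J \<or> j \<in> J)"
  proof (cases "0 \<in> Y")
    case True
    then have "card (insert 0 (Suc ` I)) \<le> card Y"
      by (intro card_mono fin) (auto simp: I_def)
    then have "card I \<le> k" using Y(2) cI finI by simp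
    then show ?thesis using I by blast
  next
    case False
    show ?thesis
    proof (cases "\<exists>i j. i < length (cover N) \<and> j < length (cover N) \<and>
      link N (cover N) (cover N ! i) (cover N ! j)")
      case True
      then obtain i j where "i < length (cover N)" "j < length (cover N)"
        "link N (cover N) (cover N ! i) (cover N ! j)"
        by blast
      \<comment> \<open>Without the root, the cover must contain both ends of every link. Dropping
        one vertex \<open>i\<close> saves the extra unit and leaves each link at least one
        end.\<close>
      have mem: "i \<in> I" if "i < length (cover N)" "j < length (cover N)"
        "link N (cover N) (cover N ! i) (cover N ! j)" for i j
        using nb(2)[OF that] Y(3) False by (auto simp: I_def vertex_cover_def)
      then have i: "i \<in> I" using \<open>i < _\<close> \<open>j < _\<close> \<open>link _ _ _ _\<close> by blast
      have "card (Suc ` I) \<le> card Y" by (intro card_mono fin) (auto simp: I_def)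
      then have "card (I - {i}) \<le> k" using Y(2) cI i finI by simp
      moreover have "a \<in> I - {i} \<or> b \<in> I - {i}" if "a < length (cover N)" "b < length (cover N)"
        "link N (cover N) (cover N ! a) (cover N ! b)" for a b
        using mem[OF that] mem[OF that(2,1)] that(3) link_sym link_irrefl
          by (metis Diff_iff singletonD)
      ultimately show ?thesis by (intro exI[of _ "I - {i}"]) blast
    next
      case no_link: False
      then show ?thesis by (intro exI[of _ "{}"]) auto
    qed
  qed
  then obtain J where J: "J \<subseteq> I" "card J \<le> k" "\<And>i j. i < length (cover N) \<Longrightarrow> j < length (cover N) \<Longrightarrow>
      link N (cover N) (cover N ! i) (cover N ! j) \<Longrightarrow> i \<in> J \<or> j \<in> J" by blast
  have "card ((!) (cover N) ` J) \<le> k"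
    using card_image_le[of J "(!) (cover N)"] J finI finite_subset le_trans by blast
  moreover have "(!) (cover N) ` J \<subseteq> set (cover N)" using J(1) I_less by auto
  moreover have "vertex_cover cover_link ((!) (cover N) ` J)"
    unfolding vertex_cover_def
  proof (intro allI impI)
    fix a b assume ab: "cover_link a b"
    then obtain i j where "i < length (cover N)" "a = cover N ! i" "j < length (cover N)"
      "b = cover N ! j"
      unfolding in_set_conv_nth by blast
    then show "a \<in> (!) (cover N) ` J \<or> b \<in> (!) (cover N) ` J" using J(3)[of i j] ab by blast
  qed
  ultimately show "\<exists>Z \<subseteq> set (cover N). card Z \<le> k \<and> vertex_cover cover_link Z" by blast
qed

end

section \<open>Correctness of the binary arithmetic\<close>

lemma bits_0: "bits 0 = []"
  by (subst bits.simps) simp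

lemma bits_Suc_0: "bits (Suc 0) = [True]"
  by (subst bits.simps) (simp add: bits_0)

text \<open>The result must be the canonical expansion, since \<open>enc_inst\<close> stores
  \<open>bits\<close>; equality of values would not suffice. Hence the induction on the number,
  generalised over the carry and the digits already written.\<close>

lemma incr_bits: "incr (bits k) = bits (k + 1)"
proof -
  let ?f = "\<lambda>(a :: bool \<times> bool list) b. (fst a \<and> b = True, (fst a \<noteq> b) # snd a)"
  let ?r = "\<lambda>p :: bool \<times> bool list. rev (if fst p then True # snd p else snd p)"
  have "?r (foldl ?f (c, out) (bits k)) = rev out @ bits (k + of_bool c)" for c out
  proof (induction k arbitrary: c out rule: less_induct)
    case (less k)
    show ?case
    proof (cases "k = 0")
      case True
      then show ?thesis by (simp add: bits_0 bits_Suc_0)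
    next
      case False
      have "(k + of_bool c) div 2 = k div 2 + of_bool (c \<and> odd k)"
        by (cases c; cases "even k") (auto elim!: evenE oddE)
      then have "bits (k + of_bool c) = (c \<noteq> odd k) # bits (k div 2 + of_bool (c \<and> odd k))"
        using False by (subst bits.simps) auto
      moreover have "bits k = odd k # bits (k div 2)" using False by (subst bits.simps) simp
      then have "foldl ?f (c, out) (bits k) =
          foldl ?f (c \<and> odd k, (c \<noteq> odd k) # out) (bits (k div 2))" by simp
      moreover have "?r (foldl ?f (c \<and> odd k, (c \<noteq> odd k) # out) (bits (k div 2))) =
          rev ((c \<noteq> odd k) # out) @ bits (k div 2 + of_bool (c \<and> odd k))"
        by (rule less) (use False in simp)
      ultimately show ?thesis by (simp only: rev.simps append_assoc append.simps)
    qed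
  qed
  from this[of True "[]"] show ?thesis
    unfolding incr_def ripple_def by (simp only: rev.simps append.simps of_bool_eq)
qed

text \<open>Counting down leaves zeros at the top, so its numbers need not be of the form
  \<open>bits k\<close>; they are compared by value.\<close>

definition bval :: "bool list \<Rightarrow> nat" where
  "bval bs = foldr (\<lambda>b a. of_bool b + 2 * a) bs 0"

lemma bval_simps [simp]: "bval [] = 0" "bval (b # bs) = of_bool b + 2 * bval bs"
  by (simp_all add: bval_def)

lemma bval_bits: "bval (bits k) = k"
proof (induction k rule: less_induct)
  case (less k)
  then show ?case by (cases "k = 0") (auto simp: bits_0 bits.simps[of k])
qed

lemma ripple_False:
  "fst (ripple False bs) \<longleftrightarrow> bval bs = 0"
  "bval bs \<noteq> 0 \<Longrightarrow> bval (rev (snd (ripple False bs))) + 1 = bval bs"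
proof -
  let ?f = "\<lambda>(a :: bool \<times> bool list) b. (fst a \<and> b = False, (fst a \<noteq> b) # snd a)"
  \<comment> \<open>With \<open>c\<close> as incoming borrow, the new digits \<open>ds\<close> have
    the value of \<open>bs\<close> minus the borrow, except when the borrow runs through to the end.
    This happens exactly at value 0, where the result wraps around.\<close>
  have *: "\<exists>ds. snd (foldl ?f (c, out) bs) = rev ds @ out \<and>
      (fst (foldl ?f (c, out) bs) \<longleftrightarrow> c \<and> bval bs = 0) \<and>
      (\<not> (c \<and> bval bs = 0) \<longrightarrow> bval ds + of_bool c = bval bs)" for c out
  proof (induction bs arbitrary: c out)
    case (Cons b bs)
    obtain ds where "snd (foldl ?f (c \<and> \<not> b, (c \<noteq> b) # out) bs) = rev ds @ (c \<noteq> b) # out"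
      "fst (foldl ?f (c \<and> \<not> b, (c \<noteq> b) # out) bs) \<longleftrightarrow> (c \<and> \<not> b) \<and> bval bs = 0"
      "\<not> ((c \<and> \<not> b) \<and> bval bs = 0) \<longrightarrow> bval ds + of_bool (c \<and> \<not> b) = bval bs"
      using Cons.IH[of "c \<and> \<not> b" "(c \<noteq> b) # out"] by blast
    then show ?case
      by (intro exI[of _ "(c \<noteq> b) # ds"]) (cases c; cases b; auto)
  qed simp
  show "fst (ripple False bs) \<longleftrightarrow> bval bs = 0"
    using *[of True "[]"] by (auto simp: ripple_def)
  show "bval bs \<noteq> 0 \<Longrightarrow> bval (rev (snd (ripple False bs))) + 1 = bval bs"
    using *[of True "[]"] by (auto simp: ripple_def)
qed

lemma countdown_iff: "fst (countdown xs bs) \<longleftrightarrow> length xs \<le> bval bs"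
proof -
  have "(fst (countdown xs bs) \<longleftrightarrow> length xs \<le> bval bs) \<and>
    (length xs \<le> bval bs \<longrightarrow> bval (snd (countdown xs bs)) + length xs = bval bs)"
  proof (induction xs rule: rev_induct)
    case (snoc x xs)
    have "countdown (xs @ [x]) bs = (let p = countdown xs bs in
        (fst p \<and> \<not> fst (ripple False (snd p)), rev (snd (ripple False (snd p)))))"
      by (simp add: countdown_def Let_def)
    then show ?case
      using snoc ripple_False[of "snd (countdown xs bs)"] by (auto simp: Let_def)
  qed (simp add: countdown_def)
  then show ?thesis by simp
qed

section \<open>The computed nonbridges of an adjacency matrix\<close>

lemma case_drop_map_upt:
  "(case drop i (map h [0..<n]) of [] \<Rightarrow> c | x # _ \<Rightarrow> d x) = (if i < n then d (h i) else c)"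
proof (cases "i < n")
  case True
  then have "drop i (map h [0..<n]) = h i # drop (Suc i) (map h [0..<n])"
    by (simp add: Cons_nth_drop_Suc[symmetric] del: drop_map)
  with True show ?thesis by (simp del: drop_map)
qed simp

lemma entry_matrix:
  "entry (map (\<lambda>u. map (f u) [0..<n]) [0..<n]) u v \<longleftrightarrow> u < n \<and> v < n \<and> f u v"
  unfolding entry_def case_drop_map_upt by simp

context
  fixes G :: "nat graph" and n :: nat
  assumes G: "simple_graph G" and verts: "verts G = {..<n}"
begin

lemma edge_less: "{u, v} \<in> edges G \<Longrightarrow> u < n \<and> v < n \<and> u \<noteq> v"
  using G verts by (fastforce simp: simple_graph_def)

lemma adj_matrix: "adj_matrix G = map (\<lambda>u. map (\<lambda>v. {u, v} \<in> edges G) [0..<n]) [0..<n]"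
  by (simp add: adj_matrix_def verts)

lemma entry_adj_matrix: "entry (adj_matrix G) u v \<longleftrightarrow> {u, v} \<in> edges G"
  unfolding adj_matrix entry_matrix using edge_less by blast

text \<open>After i rounds the list holds the vertices reachable in at most i steps. The step
  relation is a set of at most n * n pairs, and no more steps than pairs are ever needed; the matrix
  has exactly n * n entries to count them.\<close>

lemma set_reach:
  assumes u: "u < n"
  shows "set (reach (adj_matrix G) u v) = {w. (step_avoiding G {u, v})\<^sup>*\<^sup>* u w}"
proof -
  let ?R = "{(z, w). step_avoiding G {u, v} z w}"
  have R: "?R \<subseteq> {..<n} \<times> {..<n}" using edge_less by (auto simp: step_avoiding_def)
  then have fin: "finite ?R" by (rule finite_subset) simp
  have len: "length (concat (adj_matrix G)) = n * n"
    by (simp add: adj_matrix length_concat o_def sum_list_triv)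
  have expand: "set (expand (adj_matrix G) u v L) = {w. w < n \<and> (\<exists>z\<in>set L. z = w \<or> (z, w) \<in> ?R)}"
    for L
  proof -
    have "length (adj_matrix G) = n" by (simp add: adj_matrix)
    then show ?thesis
      unfolding expand_def entry_adj_matrix by (auto simp: step_avoiding_def doubleton_eq_iff)
  qed
  have "set (foldl (\<lambda>L _. expand (adj_matrix G) u v L) [u] ys) = {w. \<exists>i\<le>length ys. (u, w) \<in> ?R ^^
    i}"
    for ys :: "bool list"
  proof (induction ys rule: rev_induct)
    case (snoc y ys)
    have less: "w < n" if "(u, w) \<in> ?R ^^ i" for i w
      using that u R by (cases i) auto
    show ?case
      unfolding foldl_append foldl.simps expand snoc
    proof (intro Collect_cong iffI)
      fix w assume "w < n \<and> (\<exists>z\<in>{w. \<exists>i\<le>length ys. (u, w) \<in> ?R ^^ i}. z = w \<or> (z, w) \<in> ?R)"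
      then obtain z i where "i \<le> length ys" "(u, z) \<in> ?R ^^ i" "z = w \<or> (z, w) \<in> ?R" by blast
      then show "\<exists>i\<le>length (ys @ [y]). (u, w) \<in> ?R ^^ i"
        using relpow_Suc_I[of u z i ?R w] by (metis Suc_le_mono le_SucI length_append_singleton)
    next
      fix w assume "\<exists>i\<le>length (ys @ [y]). (u, w) \<in> ?R ^^ i"
      then obtain i where i: "i \<le> Suc (length ys)" "(u, w) \<in> ?R ^^ i" by auto
      show "w < n \<and> (\<exists>z\<in>{w. \<exists>i\<le>length ys. (u, w) \<in> ?R ^^ i}. z = w \<or> (z, w) \<in> ?R)"
      proof (cases "i \<le> length ys")
        case True
        then show ?thesis using i less by blast
      next
        case False
        then have "(u, w) \<in> ?R ^^ Suc (length ys)" using i by (simp add: le_Suc_eq)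
        then obtain z where "(u, z) \<in> ?R ^^ length ys" "(z, w) \<in> ?R" by (rule relpow_Suc_E)
        then show ?thesis using less[OF i(2)] by blast
      qed
    qed
  qed auto
  from this[of "concat (adj_matrix G)"]
  have "set (reach (adj_matrix G) u v) = {w. \<exists>i\<le>n * n. (u, w) \<in> ?R ^^ i}"
    unfolding reach_def len .
  also have "\<dots> = {w. (u, w) \<in> ?R\<^sup>*}"
  proof -
    have "card ?R \<le> n * n" using card_mono[OF _ R] by simp
    then have "(u, w) \<in> ?R\<^sup>* \<Longrightarrow> \<exists>i\<le>n * n. (u, w) \<in> ?R ^^ i" for w
      unfolding rtrancl_finite_eq_relpow[OF fin] by (blast intro: le_trans)
    then show ?thesis using relpow_imp_rtrancl by blast
  qed
  finally show ?thesis by (simp add: rtranclp_rtrancl_eq)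
qed

lemma entry_nonbridges: "entry (nonbridges (adj_matrix G)) u v \<longleftrightarrow> nonbridge G u v"
proof -
  have len: "length (adj_matrix G) = n" by (simp add: adj_matrix)
  show ?thesis
    unfolding nonbridges_def len entry_matrix entry_adj_matrix nonbridge_def
    using edge_less set_reach by auto
qed

lemma length_nonbridges: "length (nonbridges (adj_matrix G)) = n"
  by (simp add: nonbridges_def adj_matrix)

lemma double_cover_nonbridges: "double_cover (nonbridges (adj_matrix G))"
proof (rule double_cover.intro, unfold entry_nonbridges length_nonbridges)
  show "\<not> nonbridge G v v" for v using edge_less[of v v] by (auto simp: nonbridge_def)
  show "nonbridge G u v \<Longrightarrow> u < n \<and> v < n" for u v
    using edge_less[of u v] by (simp add: nonbridge_def)
  show "nonbridge G u v \<Longrightarrow> nonbridge G v u" for u v by (rule nonbridge_sym)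
qed

end

context double_cover
begin

lemma adj_matrix_kernel_graph: "adj_matrix kernel_graph = kernel_matrix N (cover N)"
proof -
  have "card (verts kernel_graph) = length root_cover" by (simp add: kernel_graph_def)
  then show ?thesis
    unfolding kernel_matrix_def root_cover_def[symmetric] adj_matrix_def Let_def
    by (intro nth_equalityI) (auto simp: kernel_edge)
qed

end

section \<open>The kernelization on instances\<close>

definition kernel_inst :: "inst \<Rightarrow> inst" where
  "kernel_inst = (\<lambda>(G, k). let N = nonbridges (adj_matrix G) in
     if length (cover N) \<le> 2 * k then (double_cover.kernel_graph N, k + 1)
     else (\<lparr> verts = {..<3}, edges = {{0, 1}, {1, 2}, {2, 0}} \<rparr>, 0))"

lemma enc_inst_eq: "enc_inst (G, k) = enc (adj_matrix G, bits k)"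
  by (simp add: enc_inst_def enc_list_def enc_bool_def)

lemma polynomial_time_kernel_inst: "polynomial_time_on instances enc_inst kernel_inst"
proof (rule ptime_polynomial_time_on[OF ptime_kernel])
  fix x assume "x \<in> instances"
  then obtain G k where x: "x = (G, k)" "simple_graph G" "verts G = {..<card (verts G)}"
    by (auto simp: instances_def)
  let ?N = "nonbridges (adj_matrix G)"
  interpret double_cover ?N by (rule double_cover_nonbridges[OF x(2,3)])
  have fits: "fst (countdown (cover ?N) (False # bits k)) \<longleftrightarrow> length (cover ?N) \<le> 2 * k"
    by (simp add: countdown_iff bval_bits)
  have "adj_matrix \<lparr> verts = {..<3}, edges = {{0, 1}, {1, 2}, {2, 0}} \<rparr> =
      [[False, True, True], [True, False, True], [True, True, False]]"
    by (simp add: adj_matrix_def upt_rec numeral_eq_Suc doubleton_eq_iff)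
  then have "enc_inst (kernel_inst x) = enc (kernel (adj_matrix G, bits k))"
    by (simp add: kernel_inst_def kernel_def fits x Let_def enc_inst_eq adj_matrix_kernel_graph
      incr_bits bits_0 del: enc_simps)
  then show "enc_inst x = enc (case x of (G, k) \<Rightarrow> (adj_matrix G, bits k)) \<and>
      enc_inst (kernel_inst x) = enc (kernel (case x of (G, k) \<Rightarrow> (adj_matrix G, bits k)))"
    by (simp add: x enc_inst_eq del: enc_simps)
qed

lemma kernel_inst_correct:
  assumes inst: "(G, k) \<in> instances" and eq: "kernel_inst (G, k) = (G', k')"
  shows "(G', k') \<in> instances \<and>
    (Identification_to_Forest (G, k) \<longleftrightarrow> Identification_to_Forest (G', k')) \<and>
    card (verts G') \<le> (if k = 0 \<and> \<not> Identification_to_Forest (G, k) then 3 else 2 * k + 1) \<and>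
    k' \<le> k + 1"
proof -
  have G: "simple_graph G" "verts G = {..<card (verts G)}" using inst by (auto simp: instances_def)
  let ?N = "nonbridges (adj_matrix G)"
  interpret double_cover ?N by (rule double_cover_nonbridges[OF G])
  have "Identification_to_Forest (G, k) \<longleftrightarrow>
      (\<exists>X \<subseteq> {..<length ?N}. card X \<le> k \<and> vertex_cover (entry ?N) X)"
    using identification_to_forest_iff_vertex_cover[OF G(1)] G(2)
    by (simp add: Identification_to_Forest_def vertex_cover_def length_nonbridges[OF G]
      entry_nonbridges[OF G])
  also note vertex_cover_kernel
  also note vertex_cover_root
  finally have iff: "Identification_to_Forest (G, k) \<longleftrightarrow>
      length (cover ?N) \<le> 2 * k \<and> Identification_to_Forest (kernel_graph, k + 1)"
    using identification_to_forest_iff_vertex_cover[OF simple_kernel_graph]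
    by (simp add: Identification_to_Forest_def vertex_cover_def)
  show ?thesis
  proof (cases "length (cover ?N) \<le> 2 * k")
    case True
    then have "G' = kernel_graph" "k' = k + 1" using eq by (auto simp: kernel_inst_def Let_def)
    moreover have "verts kernel_graph = {..<Suc (length (cover ?N))}"
      by (simp add: kernel_graph_def root_cover_def)
    ultimately show ?thesis using iff True simple_kernel_graph by (simp add: instances_def)
  next
    case False
    then have "G' = \<lparr> verts = {..<3}, edges = {{0, 1}, {1, 2}, {2, 0}} \<rparr>" "k' = 0"
      using eq by (auto simp: kernel_inst_def Let_def)
    \<comment> \<open>By \<open>iff\<close> the given instance is negative. The three vertices are
      within 2k + 1 for k \<ge> 1, and k = 0 falls under the exception in the bound.\<close>
    then show ?thesis using iff False triangle_not_Identification_to_Forest by auto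
  qed
qed

theorem theorem1p1:
  "\<exists>A :: inst \<Rightarrow> inst.
     polynomial_time_on instances enc_inst A \<and>
     (\<forall>G k G' k'. (G, k) \<in> instances \<and> A (G, k) = (G', k') \<longrightarrow>
        (G', k') \<in> instances \<and>
        (Identification_to_Forest (G, k) \<longleftrightarrow> Identification_to_Forest (G', k')) \<and>
        card (verts G') \<le>
          (if k = 0 \<and> \<not> Identification_to_Forest (G, k) then 3 else 2 * k + 1) \<and>
        k' \<le> k + 1)"
  using polynomial_time_kernel_inst kernel_inst_correct by blast

end
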